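(* Let $p$ be an odd prime, $\mathbb{F}_p$ the field with $p$ elements, $k\ge 2$ an integer, $d=2k$, and $A\subset \mathbb{F}_p$. Put $\mathcal{E}=A^d\subset\mathbb{F}_p^d$ and $\varepsilon=\frac{d}{2}\cdot \frac{2^k-2^{k-1}-1}{2^{k}-1}$. There is a constant $C>0$ (independent of $p$ and $A$) such that if $|\mathcal{E}|\ge C\, p^{\frac{d}{2}-\varepsilon}$, then \[\left\vert\frac{\Delta(\mathcal{E})}{\Delta(\mathcal{E})}\right\vert\ge \frac{p}{3}.\]
   Context: For $\mathbf{x}=(x_1,\dots,x_d),\mathbf{y}=(y_1,\dots,y_d)\in\mathbb{F}_p^d$, the distance is $\|\mathbf{x}-\mathbf{y}\|=(x_1-y_1)^2+\cdots+(x_d-y_d)^2\in\mathbb{F}_p$. For $\mathcal{E}\subset\mathbb{F}_p^d$, the distance set is $\Delta(\mathcal{E})=\{\|\mathbf{x}-\mathbf{y}\|:\mathbf{x},\mathbf{y}\in\mathcal{E}\}$, and its quotient set is $\frac{\Delta(\mathcal{E})}{\Delta(\mathcal{E})}=\{a/b: a,b\in\Delta(\mathcal{E}),\ b\neq 0\}$. *)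

theory Defs
  imports Complex_Main "HOL-Library.FuncSet" "HOL-Number_Theory.Cong"
begin

text \<open>F_p is modelled by the residues {0..<p} :: int set with arithmetic mod p.
  Points of F_p^d are functions nat => int, extensional outside {0..<d}.\<close>

definition point_set :: "nat \<Rightarrow> int set \<Rightarrow> (nat \<Rightarrow> int) set" where
  "point_set d A = PiE {0..<d} (\<lambda>_. A)"

definition fp_dist :: "nat \<Rightarrow> nat \<Rightarrow> (nat \<Rightarrow> int) \<Rightarrow> (nat \<Rightarrow> int) \<Rightarrow> int" where
  "fp_dist p d x y = (\<Sum>i<d. (x i - y i)^2) mod int p"

definition dist_set :: "nat \<Rightarrow> nat \<Rightarrow> (nat \<Rightarrow> int) set \<Rightarrow> int set" where
  "dist_set p d E = {fp_dist p d x y | x y. x \<in> E \<and> y \<in> E}"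

definition quot_set :: "nat \<Rightarrow> int set \<Rightarrow> int set" where
  "quot_set p D = {c \<in> {0..<int p}. \<exists>a\<in>D. \<exists>b\<in>D. b \<noteq> 0 \<and> [c * b = a] (mod int p)}"

end

theory Submission
  imports Defs "HOL-Analysis.Convex" "Berlekamp_Zassenhaus.Finite_Field"
begin

text \<open>Let \<open>R\<^sub>j\<close> be the set of sums of \<open>j\<close> squares of differences of elements of \<open>A\<close>. The key estimate is
  \<open>|R\<^sub>j\<^sub>+\<^sub>1| \<ge> |A| * |R\<^sub>j|\<^sup>1\<^sup>/\<^sup>2 / 512\<close>. Iterated, it gives \<open>|R\<^sub>k| \<ge> 2 * p\<^sup>1\<^sup>/\<^sup>2\<close>, and then a second moment
  argument over \<open>t\<close> shows that most \<open>t\<close> are quotients of elements of \<open>R\<^sub>k + R\<^sub>k = R\<^sub>2\<^sub>k\<close>.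

  Solutions of \<open>(x - y)\<^sup>2 + z = (x' - y')\<^sup>2 + z'\<close> are incidences between null lines
  \<open>{(\<tau>, b + s * \<tau>, d + s\<^sup>2 * \<tau>)}\<close> in 3-space. If the estimate failed, there would be a family of such lines each of
  which meets far more of the others than the degree of a polynomial \<open>P\<close> of minimal degree that vanishes on all of
  them. At a crossing point both slopes are roots of \<open>P\<^sub>X + s * P\<^sub>Y + s\<^sup>2 * P\<^sub>Z\<close>, so the slope \<open>t\<close> of the crossing line
  is a rational function on the given line of slope \<open>s\<close>. Counting zeros, the Hessian of \<open>P\<close> vanishes at the other null
  direction along every line; differentiating this along the crossing lines shows that \<open>1 / (t - s)\<close> has vanishing second
  derivative. As the degree is below the characteristic, it is linear, so all crossing lines satisfy one linear equation in
  slope and offset, which only few lines do.\<close>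

section \<open>Polynomials in three variables restricted to null lines\<close>

lemma poly_eq_0_if_many_roots:
  fixes q :: "'a::idom poly"
  assumes "finite S" and "inj_on f S" and "\<And>j. j \<in> S \<Longrightarrow> poly q (f j) = 0"
    and "degree q < card S"
  shows "q = 0"
proof (rule ccontr)
  assume "q \<noteq> 0"
  have "card S = card (f ` S)"
    using assms(2) by (simp add: card_image)
  also have "\<dots> \<le> card {x. poly q x = 0}"
    using assms(3) poly_roots_finite[OF \<open>q \<noteq> 0\<close>] by (intro card_mono) auto
  also have "\<dots> \<le> degree q"
    using \<open>q \<noteq> 0\<close> by (rule card_poly_roots_bound)
  finally show False
    using assms(4) by simp
qed

text \<open>The hypothesis \<open>wr\<close> means that f / g has derivative 0. The top coefficients
  of its two sides are deg f and deg g times the same nonzero number, and no positive integer up to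
  M vanishes in the field, so every nonzero solution f has the degree of g.\<close>

lemma wronskian_zero_imp_proportional:
  fixes f g :: "'a::field poly"
  assumes char: "\<And>i. 0 < i \<Longrightarrow> i \<le> M \<Longrightarrow> of_nat i \<noteq> (0::'a)"
    and deg: "degree f \<le> M" "degree g \<le> M"
    and g: "g \<noteq> 0" and wr: "pderiv f * g = f * pderiv g"
  obtains c where "f = smult c g"
proof -
  have same_degree: "degree f = degree g"
    if "f \<noteq> 0" "degree f \<le> M" "pderiv f * g = f * pderiv g" for f
  proof (rule ccontr)
    assume ne: "degree f \<noteq> degree g"
    have lead: "coeff (pderiv f * g) (degree f + degree g - 1) = of_nat (degree f) * lead_coeff f * lead_coeff g"
      if "f \<noteq> 0" "g \<noteq> 0" for f g :: "'a poly"
    proof (cases "degree f")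
      case 0
      then have "pderiv f = 0"
        by (simp add: poly_eq_iff coeff_pderiv coeff_eq_0)
      then show ?thesis using 0 by simp
    next
      case (Suc k)
      have "degree (pderiv f) \<le> k"
        using Suc by (intro degree_le) (simp add: coeff_pderiv coeff_eq_0)
      have "coeff (pderiv f * g) (k + degree g) =
          (\<Sum>i\<le>k + degree g. if i = k then coeff (pderiv f) k * coeff g (degree g) else 0)"
        unfolding coeff_mult
      proof (intro sum.cong refl)
        fix i
        show "coeff (pderiv f) i * coeff g (k + degree g - i) =
            (if i = k then coeff (pderiv f) k * coeff g (degree g) else 0)"
          using \<open>degree (pderiv f) \<le> k\<close> by (cases i k rule: linorder_cases) (auto simp: coeff_eq_0)
      qed
      then show ?thesis using Suc by (simp add: coeff_pderiv)
    qed
    have "of_nat (degree f) * lead_coeff f * lead_coeff g = of_nat (degree g) * lead_coeff g * lead_coeff f"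
      using lead[OF that(1) g] lead[OF g that(1)] that(3)
      by (auto simp: add.commute mult.commute)
    then have eq: "(of_nat (degree f) :: 'a) = of_nat (degree g)"
      using that(1) g by (simp add: mult.commute)
    show False
    proof (cases "degree f < degree g")
      case True
      then have "of_nat (degree g - degree f) = (0::'a)"
        using eq by (simp add: of_nat_diff)
      then show False using char[of "degree g - degree f"] True deg(2) by linarith
    next
      case False
      then have "of_nat (degree f - degree g) = (0::'a)"
        using eq by (simp add: of_nat_diff)
      then show False using char[of "degree f - degree g"] False ne that(2) by linarith
    qed
  qed
  \<comment> \<open>This multiple of g cancels the coefficient at \<open>degree g\<close>. The
    difference h solves the same equation, so by \<open>same_degree\<close> it can only be
    0.\<close>
  define c where "c = coeff f (degree g) / lead_coeff g"
  define h where "h = f - smult c g"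
  have "coeff h (degree g) = 0"
    using g by (simp add: h_def c_def)
  have "degree h \<le> M"
    unfolding h_def using deg by (meson degree_diff_le degree_smult_le order_trans)
  moreover have "pderiv h * g = h * pderiv g"
    unfolding h_def using wr by (simp add: pderiv_diff pderiv_smult algebra_simps)
  ultimately have "h = 0"
    using same_degree[of h] \<open>coeff h (degree g) = 0\<close> by (metis leading_coeff_0_iff)
  then show thesis using that[of c] by (simp add: h_def)
qed

section \<open>Trivariate polynomials, formal partial derivatives and the chain rule\<close>

text \<open>A trivariate polynomial is a coefficient function on exponent triples supported on
  \<open>simplex D\<close>, the triples of total degree at most \<open>D\<close>.\<close>

definition simplex :: "nat \<Rightarrow> (nat \<times> nat \<times> nat) set" where
  "simplex D = {(a, b, d). a + b + d \<le> D}"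

definition supported :: "nat \<Rightarrow> (nat \<times> nat \<times> nat \<Rightarrow> 'a::zero) \<Rightarrow> bool" where
  "supported D c \<longleftrightarrow> (\<forall>e. e \<notin> simplex D \<longrightarrow> c e = 0)"

definition tri_poly ::
    "nat \<Rightarrow> (nat \<times> nat \<times> nat \<Rightarrow> 'a::comm_ring_1) \<Rightarrow> 'a poly \<Rightarrow> 'a poly \<Rightarrow> 'a poly \<Rightarrow> 'a poly" where
  "tri_poly D c x y z = (\<Sum>(a, b, d)\<in>simplex D. smult (c (a, b, d)) (x ^ a * y ^ b * z ^ d))"

definition dX :: "(nat \<times> nat \<times> nat \<Rightarrow> 'a::comm_ring_1) \<Rightarrow> nat \<times> nat \<times> nat \<Rightarrow> 'a" where
  "dX c = (\<lambda>(a, b, d). of_nat (Suc a) * c (Suc a, b, d))"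

definition dY :: "(nat \<times> nat \<times> nat \<Rightarrow> 'a::comm_ring_1) \<Rightarrow> nat \<times> nat \<times> nat \<Rightarrow> 'a" where
  "dY c = (\<lambda>(a, b, d). of_nat (Suc b) * c (a, Suc b, d))"

definition dZ :: "(nat \<times> nat \<times> nat \<Rightarrow> 'a::comm_ring_1) \<Rightarrow> nat \<times> nat \<times> nat \<Rightarrow> 'a" where
  "dZ c = (\<lambda>(a, b, d). of_nat (Suc d) * c (a, b, Suc d))"

lemma finite_simplex [simp]: "finite (simplex D)"
proof (rule finite_subset)
  show "simplex D \<subseteq> {..D} \<times> {..D} \<times> {..D}" by (auto simp: simplex_def)
qed simp

lemma card_simplex_ge: "(m + 1) ^ 3 \<le> card (simplex (3 * m))"
proof -
  have "card ({..m} \<times> {..m} \<times> {..m}) \<le> card (simplex (3 * m))"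
    by (intro card_mono finite_simplex) (auto simp: simplex_def)
  then show ?thesis by (simp add: card_cartesian_product power3_eq_cube mult.assoc del: add_mult_distrib2 add_mult_distrib mult_Suc mult_Suc_right)
qed

lemma partials_commute:
  "dY (dX c) = dX (dY c)" "dZ (dX c) = dX (dZ c)" "dZ (dY c) = dY (dZ c)"
  by (auto simp: dX_def dY_def dZ_def fun_eq_iff algebra_simps)

lemma supported_partials:
  assumes "supported D c"
  shows "supported (D - 1) (dX c)" "supported (D - 1) (dY c)" "supported (D - 1) (dZ c)"
  using assms by (auto simp: supported_def simplex_def dX_def dY_def dZ_def)

lemma supported_mono: "supported D c \<Longrightarrow> D \<le> D' \<Longrightarrow> supported D' c"
  by (auto simp: supported_def simplex_def)

lemma supported_partials':
  assumes "supported D c"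
  shows "supported D (dX c)" "supported D (dY c)" "supported D (dZ c)"
  using supported_partials[OF assms] supported_mono by (metis diff_le_self)+

lemma tri_poly_supported:
  assumes "supported E c" "E \<le> D"
  shows "tri_poly D c x y z = tri_poly E c x y z"
  unfolding tri_poly_def
proof (rule sum.mono_neutral_right)
  show "simplex E \<subseteq> simplex D" using assms(2) by (auto simp: simplex_def)
  show "\<forall>e\<in>simplex D - simplex E. (case e of (a, b, d) \<Rightarrow> smult (c (a, b, d)) (x ^ a * y ^ b * z ^ d)) = 0"
    using assms(1) by (auto simp: supported_def)
qed simp

text \<open>The chain rule for P along the polynomial curve (x, y, z).\<close>

lemma pderiv_tri_poly:
  fixes c :: "nat \<times> nat \<times> nat \<Rightarrow> 'a::{comm_ring_1,ring_no_zero_divisors}"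
  assumes c: "supported D c"
  shows "pderiv (tri_poly D c x y z) =
    pderiv x * tri_poly D (dX c) x y z + pderiv y * tri_poly D (dY c) x y z + pderiv z * tri_poly D (dZ c) x y z"
proof -
  \<comment> \<open>Lowering the exponent of x reindexes the sum. Summands with \<open>a = 0\<close>
    vanish on the left, and those of total degree D on the right by the support of c. The map
    \<open>j\<close> sends exponent 0 to D because \<open>dX c\<close> vanishes there, so the
    summands agree on the excluded triples too.\<close>
  have X: "(\<Sum>(a, b, d)\<in>simplex D. smult (of_nat a * c (a, b, d)) (x ^ (a - 1) * y ^ b * z ^ d)) =
      tri_poly D (dX c) x y z"
    unfolding tri_poly_def
    by (rule sum.reindex_bij_witness_not_neutral
        [where S' = "{(a, b, d) \<in> simplex D. a = 0}" and T' = "{(a, b, d) \<in> simplex D. a + b + d = D}"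
          and i = "\<lambda>(a, b, d). (Suc a, b, d)" and j = "\<lambda>(a, b, d). (if a = 0 then D else a - 1, b, d)"])
      (use c in \<open>auto simp: dX_def supported_def simplex_def intro: finite_subset[OF _ finite_simplex[of D]]\<close>)
  have Y: "(\<Sum>(a, b, d)\<in>simplex D. smult (of_nat b * c (a, b, d)) (x ^ a * y ^ (b - 1) * z ^ d)) =
      tri_poly D (dY c) x y z"
    unfolding tri_poly_def
    by (rule sum.reindex_bij_witness_not_neutral
        [where S' = "{(a, b, d) \<in> simplex D. b = 0}" and T' = "{(a, b, d) \<in> simplex D. a + b + d = D}"
          and i = "\<lambda>(a, b, d). (a, Suc b, d)" and j = "\<lambda>(a, b, d). (a, if b = 0 then D else b - 1, d)"])
      (use c in \<open>auto simp: dY_def supported_def simplex_def intro: finite_subset[OF _ finite_simplex[of D]]\<close>)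
  have Z: "(\<Sum>(a, b, d)\<in>simplex D. smult (of_nat d * c (a, b, d)) (x ^ a * y ^ b * z ^ (d - 1))) =
      tri_poly D (dZ c) x y z"
    unfolding tri_poly_def
    by (rule sum.reindex_bij_witness_not_neutral
        [where S' = "{(a, b, d) \<in> simplex D. d = 0}" and T' = "{(a, b, d) \<in> simplex D. a + b + d = D}"
          and i = "\<lambda>(a, b, d). (a, b, Suc d)" and j = "\<lambda>(a, b, d). (a, b, if d = 0 then D else d - 1)"])
      (use c in \<open>auto simp: dZ_def supported_def simplex_def intro: finite_subset[OF _ finite_simplex[of D]]\<close>)
  have mono: "pderiv (smult e (x ^ a * y ^ b * z ^ d)) =
      pderiv x * smult (of_nat a * e) (x ^ (a - 1) * y ^ b * z ^ d) +
      pderiv y * smult (of_nat b * e) (x ^ a * y ^ (b - 1) * z ^ d) +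
      pderiv z * smult (of_nat d * e) (x ^ a * y ^ b * z ^ (d - 1))" for a b d e
    by (simp add: pderiv_smult pderiv_mult pderiv_power smult_add_right ring_distribs mult_ac)
  show ?thesis
    unfolding X[symmetric] Y[symmetric] Z[symmetric]
    unfolding tri_poly_def higher_pderiv_sum[of 1, simplified] sum_distrib_left sum.distrib[symmetric]
    by (intro sum.cong) (auto simp: mono)
qed

section \<open>Restriction to null lines\<close>

definition on_line :: "nat \<Rightarrow> (nat \<times> nat \<times> nat \<Rightarrow> 'a::comm_ring_1) \<Rightarrow> 'a \<Rightarrow> 'a \<Rightarrow> 'a \<Rightarrow> 'a poly" where
  "on_line D c s b d = tri_poly D c [:0, 1:] [:b, s:] [:d, s\<^sup>2:]"

text \<open>A null line is parametrised by its first coordinate, so two of them can meet only at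
  equal parameters; there both restrictions are values of P at the same point.\<close>

lemma poly_on_line_cong:
  assumes "b + s * \<tau> = b' + s' * \<tau>" and "d + s\<^sup>2 * \<tau> = d' + s'\<^sup>2 * \<tau>"
  shows "poly (on_line D c s b d) \<tau> = poly (on_line D c s' b' d') \<tau>"
  using assms by (simp add: on_line_def tri_poly_def poly_sum split_def mult.commute)

lemma degree_on_line: "degree (on_line D c s b (d::'a::comm_ring_1)) \<le> D"
  unfolding on_line_def tri_poly_def
proof (rule degree_sum_le)
  fix e assume "e \<in> simplex D"
  moreover obtain i j k where e: "e = (i, j, k)" by (cases e)
  ultimately have ijk: "i + j + k \<le> D" by (simp add: simplex_def)
  have "degree ([:0, 1:] ^ i * [:b, s:] ^ j * [:d, s\<^sup>2:] ^ k) \<le>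
      degree ([:0, 1::'a:] ^ i) + degree ([:b, s:] ^ j) + degree ([:d, s\<^sup>2:] ^ k)"
    by (meson add_le_mono1 degree_mult_le order_trans)
  also have "\<dots> \<le> 1 * i + 1 * j + 1 * k"
    by (intro add_mono order_trans[OF degree_power_le] mult_right_mono) auto
  finally show "degree (case e of (i, j, k) \<Rightarrow>
      smult (c (i, j, k)) ([:0, 1:] ^ i * [:b, s:] ^ j * [:d, s\<^sup>2:] ^ k)) \<le> D"
    using ijk unfolding e by (simp add: order_trans[OF degree_smult_le])
qed simp

lemma pderiv_on_line:
  fixes c :: "nat \<times> nat \<times> nat \<Rightarrow> 'a::{comm_ring_1,ring_no_zero_divisors}"
  assumes "supported D c"
  shows "pderiv (on_line D c s b d) =
    on_line D (dX c) s b d + smult s (on_line D (dY c) s b d) + smult (s\<^sup>2) (on_line D (dZ c) s b d)"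
  unfolding on_line_def pderiv_tri_poly[OF assms] by (simp add: pderiv_pCons)

lemma on_line_diff:
  "on_line D (\<lambda>e. c e - c' e) s b d = on_line D c s b d - on_line D c' s b d"
  unfolding on_line_def tri_poly_def sum_subtractf[symmetric]
  by (intro sum.cong) (auto simp: smult_diff_left)

text \<open>A dimension count in the form of a pigeonhole argument over the finite field: the
  polynomials of degree at most \<open>3 * m\<close> outnumber the possible tuples of restrictions,
  so two of them have equal restrictions, and their difference vanishes on all lines.\<close>

lemma exists_vanishing_on_lines:
  fixes s b d :: "'i \<Rightarrow> 'a::{field,finite}"
  assumes "finite L" and "3 * card L \<le> (m + 1)\<^sup>2"
  obtains c where "supported (3 * m) c" "c \<noteq> (\<lambda>_. 0)"
    "\<And>i. i \<in> L \<Longrightarrow> on_line (3 * m) c (s i) (b i) (d i) = 0"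
proof -
  let ?D = "3 * m" and ?q = "CARD('a)"
  define ext :: "(nat \<times> nat \<times> nat \<Rightarrow> 'a) \<Rightarrow> nat \<times> nat \<times> nat \<Rightarrow> 'a"
    where "ext f = (\<lambda>e. if e \<in> simplex ?D then f e else 0)" for f
  define ev where "ev f = (\<lambda>(i, k)\<in>L \<times> {..?D}. coeff (on_line ?D (ext f) (s i) (b i) (d i)) k)" for f
  let ?V = "simplex ?D \<rightarrow>\<^sub>E (UNIV :: 'a set)" and ?W = "(L \<times> {..?D}) \<rightarrow>\<^sub>E (UNIV :: 'a set)"
  have q: "?q \<ge> 2"
    using card_mono[of UNIV "{0, 1::'a}"] by simp
  \<comment> \<open>Each line imposes \<open>3 * m + 1\<close> conditions, while the exponents in a
    cube of side \<open>m + 1\<close> already provide \<open>(m + 1) ^ 3\<close>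
    coefficients.\<close>
  have "card L * (?D + 1) < (m + 1) ^ 3"
  proof -
    have "card L * (?D + 1) \<le> 3 * card L * (m + 1) - 2 * card L"
      by (simp add: algebra_simps)
    also have "\<dots> < (m + 1) ^ 3"
    proof (cases "card L = 0")
      case False
      then have "3 * card L * (m + 1) - 2 * card L < 3 * card L * (m + 1)" by simp
      also have "\<dots> \<le> (m + 1)\<^sup>2 * (m + 1)" using assms(2) by (rule mult_right_mono) simp
      finally show ?thesis by (simp add: power3_eq_cube power2_eq_square)
    qed simp
    finally show ?thesis .
  qed
  then have "card L * (?D + 1) < card (simplex ?D)"
    using card_simplex_ge[of m] by simp
  then have "card ?W < card ?V"
    using q assms(1) by (simp add: card_PiE card_cartesian_product)
  moreover have "ev ` ?V \<subseteq> ?W"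
    by (auto simp: ev_def split: if_splits)
  moreover have "finite ?W"
    using assms(1) by (intro finite_PiE) auto
  ultimately have "\<not> inj_on ev ?V"
    by (metis card_inj_on_le not_less)
  then obtain f g where fg: "f \<in> ?V" "g \<in> ?V" "f \<noteq> g" "ev f = ev g"
    by (auto simp: inj_on_def)
  define c where "c = (\<lambda>e. ext f e - ext g e)"
  have "supported ?D c"
    by (simp add: c_def ext_def supported_def)
  moreover have "c \<noteq> (\<lambda>_. 0)"
  proof
    assume "c = (\<lambda>_. 0)"
    then have "ext f e = ext g e" for e by (metis c_def eq_iff_diff_eq_0)
    then have "f e = g e" if "e \<in> simplex ?D" for e using that by (metis ext_def)
    then show False using fg PiE_ext by blast
  qed
  moreover have "on_line ?D c (s i) (b i) (d i) = 0" if "i \<in> L" for i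
  proof -
    have "coeff (on_line ?D (ext f) (s i) (b i) (d i)) k = coeff (on_line ?D (ext g) (s i) (b i) (d i)) k"
      for k
    proof (cases "k \<le> ?D")
      case True
      then show ?thesis using fun_cong[OF fg(4), of "(i, k)"] that by (simp add: ev_def)
    next
      case False
      then show ?thesis using degree_on_line by (metis coeff_eq_0 le_less_trans not_le)
    qed
    then show ?thesis unfolding c_def on_line_diff by (simp add: poly_eq_iff)
  qed
  ultimately show thesis using that by blast
qed

section \<open>The differential identity at a crossing point\<close>

text \<open>The point lies on two null lines of slopes \<open>s\<close> and \<open>t\<close> in the surface \<open>P = 0\<close>. The
  letters \<open>XX\<close>, \<open>XXY\<close>, \<dots> are the higher partial derivatives of \<open>P\<close>, and \<open>w = P\<^sub>Z\<close>; the numbers \<open>u1\<close>,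
  \<open>w1\<close>, \<open>u2\<close>, \<open>w2\<close> are the first and second derivatives of \<open>P\<^sub>Y\<close> and \<open>P\<^sub>Z\<close> along the first line, \<open>b1\<close>
  and \<open>d1\<close> the first ones along the second line. Hypothesis \<open>J\<close> is the derivative along the second line of the
  statement that the Hessian vanishes at the other null direction.\<close>

lemma crossing_identity:
  fixes s t w :: "'a::field"
  assumes st: "s \<noteq> t" and w: "w \<noteq> 0"
    and Hs: "(XX + s * XY + s^2 * XZ) + s * (XY + s * YY + s^2 * YZ) + s^2 * (XZ + s * YZ + s^2 * ZZ) = 0"
    and Ht: "(XX + t * XY + t^2 * XZ) + t * (XY + t * YY + t^2 * YZ) + t^2 * (XZ + t * YZ + t^2 * ZZ) = 0"
    and u1: "u1 = XY + s * YY + s^2 * YZ" and w1: "w1 = XZ + s * YZ + s^2 * ZZ"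
    and b1: "b1 = XY + t * YY + t^2 * YZ" and d1: "d1 = XZ + t * YZ + t^2 * ZZ"
    and third: "XXX + s * XXY + s^2 * XXZ + s * (XXY + s * XYY + s^2 * XYZ) + s^2 * (XXZ + s * XYZ + s^2 * XZZ)
        + s * u2 + s^2 * w2 = 0"
    and u2: "u2 = XXY + s * XYY + s^2 * XYZ + s * (XYY + s * YYY + s^2 * YYZ) + s^2 * (XYZ + s * YYZ + s^2 * YZZ)"
    and w2: "w2 = XXZ + s * XYZ + s^2 * XZZ + s * (XYZ + s * YYZ + s^2 * YZZ) + s^2 * (XZZ + s * YZZ + s^2 * ZZZ)"
    and J: "w^4 * ((XXX + t * XXY + t^2 * XXZ) + 2 * s * (XXY + t * XYY + t^2 * XYZ)
        + s^2 * (2 * (XXZ + t * XYZ + t^2 * XZZ) + (XYY + t * YYY + t^2 * YYZ))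
        + 2 * s^3 * (XYZ + t * YYZ + t^2 * YZZ) + s^4 * (XZZ + t * YZZ + t^2 * ZZZ))
      + w^3 * (d1 * (4 * XX + 6 * s * XY + 2 * s^2 * (2 * XZ + YY) + 2 * s^3 * YZ)
        - (b1 + t * d1) * (2 * XY + 2 * s * (2 * XZ + YY) + 6 * s^2 * YZ + 4 * s^3 * ZZ)) = 0"
    and v: "v = (t - s) * w" and v1: "v1 = - (u1 + 2 * s * w1)" and v2: "v2 = - (u2 + 2 * s * w2)"
  shows "(w2 * v - w * v2) * v - 2 * v1 * (w1 * v - w * v1) = 0"
proof -
  \<comment> \<open>Let H be the Hessian and n(s) = (1, s, s^2). The difference of \<open>Hs\<close>
    and \<open>Ht\<close> pairs n(s) - n(t) with n(s) + n(t) under H, and n(s) - n(t) = (s - t) (0,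
    1, s + t).\<close>
  have "(s - t) * (b1 + (s + t) * d1 + u1 + (s + t) * w1) = 0"
    unfolding b1 d1 u1 w1 using Hs Ht by Groebner_Basis.algebra
  then have ab: "b1 + (s + t) * d1 + u1 + (s + t) * w1 = 0"
    using st by simp
  \<comment> \<open>The left side is the third derivative in the directions n(s), n(s), n(t). By
    \<open>third\<close> it vanishes at n(s), n(s), n(s), so only the direction n(t) - n(s)
    contributes.\<close>
  have T: "(XXX + t * XXY + t^2 * XXZ) + 2 * s * (XXY + t * XYY + t^2 * XYZ)
        + s^2 * (2 * (XXZ + t * XYZ + t^2 * XZZ) + (XYY + t * YYY + t^2 * YYZ))
        + 2 * s^3 * (XYZ + t * YYZ + t^2 * YZZ) + s^4 * (XZZ + t * YZZ + t^2 * ZZZ)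
      = (t - s) * (u2 + (t + s) * w2)"
    using third unfolding u2 w2 by Groebner_Basis.algebra
  \<comment> \<open>Euler's relation for the quartic n(s)^T H n(s), made homogeneous: the quartic
    vanishes at s by \<open>Hs\<close>, so both partial derivatives are multiples of its derivative
    in s, which is \<open>- 2 * v1\<close>.\<close>
  have q: "d1 * (4 * XX + 6 * s * XY + 2 * s^2 * (2 * XZ + YY) + 2 * s^3 * YZ)
        - (b1 + t * d1) * (2 * XY + 2 * s * (2 * XZ + YY) + 6 * s^2 * YZ + 4 * s^3 * ZZ)
      = 2 * v1 * (b1 + (s + t) * d1)"
    using Hs unfolding v1 u1 w1 by Groebner_Basis.algebra
  have "w^3 * (w * ((t - s) * (u2 + (t + s) * w2)) + 2 * v1 * (b1 + (s + t) * d1)) = 0"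
    using J unfolding T q by (simp add: algebra_simps power3_eq_cube power4_eq_xxxx)
  then have "w * ((t - s) * (u2 + (t + s) * w2)) + 2 * v1 * (b1 + (s + t) * d1) = 0"
    using w by simp
  moreover have "b1 + (s + t) * d1 = - (u1 + (s + t) * w1)"
    using ab by Groebner_Basis.algebra
  ultimately have key: "w * ((t - s) * (u2 + (t + s) * w2)) - 2 * v1 * (u1 + (s + t) * w1) = 0"
    by Groebner_Basis.algebra
  \<comment> \<open>The claim is the numerator of the second derivative of w / v; after substitution
    it is w times \<open>key\<close>.\<close>
  show ?thesis
    using key unfolding v v1 v2 by Groebner_Basis.algebra
qed

text \<open>The lines in \<open>nb i\<close> cross line i at distinct points. The constants follow
  the degrees: P has degree at most \<open>3 * m\<close>, the polynomial \<open>J\<close> at most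
  \<open>15 * m\<close>, at most \<open>3 * m\<close> crossings are lost as zeros of
  \<open>w\<close>, and \<open>pencil\<close> allows n crossings on the final linear equation. The
  bound in \<open>char\<close> covers the degrees in the Wronskian arguments.\<close>

lemma null_lines_incidence:
  fixes s b d :: "'i \<Rightarrow> 'a::{field,finite}"
  assumes fin: "finite L" and ne: "L \<noteq> {}"
    and nb_sub: "\<And>i. i \<in> L \<Longrightarrow> nb i \<subseteq> L"
    and nb_sym: "\<And>i j. i \<in> L \<Longrightarrow> j \<in> nb i \<Longrightarrow> i \<in> nb j"
    and meet: "\<And>i j. i \<in> L \<Longrightarrow> j \<in> nb i \<Longrightarrow> s i \<noteq> s j \<and> (b j - b i) * (s j + s i) = d j - d i"
    and inj: "\<And>i. i \<in> L \<Longrightarrow> inj_on (\<lambda>j. (b j - b i) / (s i - s j)) (nb i)"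
    and rich: "\<And>i. i \<in> L \<Longrightarrow> 15 * m + n < card (nb i)"
    and pencil: "\<And>i c k. i \<in> L \<Longrightarrow> card {j \<in> nb i. c * (s j - s i) - k * (b j - b i) = 1} \<le> n"
    and size: "3 * card L \<le> (m + 1)\<^sup>2"
    and char: "\<And>i. 0 < i \<Longrightarrow> i \<le> 6 * m + 2 \<Longrightarrow> of_nat i \<noteq> (0::'a)"
  shows False
proof -
  define vanishing where "vanishing E c \<longleftrightarrow> supported E c \<and> c \<noteq> (\<lambda>_. 0) \<and>
    (\<forall>i\<in>L. on_line E c (s i) (b i) (d i) = 0)" for E and c :: "nat \<times> nat \<times> nat \<Rightarrow> 'a"
  define E where "E = (LEAST E. \<exists>c. vanishing E c)"
  have ex: "\<exists>c. vanishing (3 * m) c"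
    using exists_vanishing_on_lines[OF fin size, of s b d] unfolding vanishing_def by metis
  then have E_le: "E \<le> 3 * m"
    unfolding E_def by (rule Least_le)
  obtain c where c: "vanishing E c"
    using LeastI[of "\<lambda>E. \<exists>c. vanishing E c", OF ex] unfolding E_def by blast
  have minimal: "\<not> vanishing E' c'" if "E' < E" for E' c'
    using not_less_Least[of E' "\<lambda>E. \<exists>c. vanishing E c"] that unfolding E_def by blast
  have sup: "supported E c"
    using c by (simp add: vanishing_def)
  \<comment> \<open>The partial derivatives keep the bound E rather than E - 1, so that one
    restriction map \<open>ev\<close> serves derivatives of all orders.\<close>
  note sup1 = supported_partials'[OF sup]
  note sup2 = supported_partials'[OF sup1(1)] supported_partials'[OF sup1(2)] supported_partials'[OF sup1(3)]
  define ev where "ev e i = on_line E e (s i) (b i) (d i)" for e i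
  define \<tau> where "\<tau> i j = (b j - b i) / (s i - s j)" for i j
  have deg: "degree (ev e i) \<le> E" for e i
    unfolding ev_def by (rule degree_on_line)
  have c0: "ev c i = 0" if "i \<in> L" for i
    using c that by (simp add: vanishing_def ev_def)
  have fin_nb: "finite (nb i)" if "i \<in> L" for i
    using nb_sub[OF that] fin finite_subset by blast
  have \<tau>_sym: "\<tau> j i = \<tau> i j" for i j
    unfolding \<tau>_def by (metis minus_diff_eq minus_divide_divide)
  have cross: "poly (ev e i) (\<tau> i j) = poly (ev e j) (\<tau> i j)" if "i \<in> L" "j \<in> nb i" for e i j
  proof -
    have 1: "\<tau> i j * (s i - s j) = b j - b i"
      using meet[OF that] by (simp add: \<tau>_def)
    have 2: "(\<tau> i j * (s i - s j)) * (s j + s i) = d j - d i"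
      using meet[OF that] 1 by simp
    show ?thesis
      unfolding ev_def
    proof (rule poly_on_line_cong)
      show "b i + s i * \<tau> i j = b j + s j * \<tau> i j" using 1 by Groebner_Basis.algebra
      show "d i + (s i)\<^sup>2 * \<tau> i j = d j + (s j)\<^sup>2 * \<tau> i j" using 2 by Groebner_Basis.algebra
    qed
  qed
  have many: "q = 0" if "i \<in> L" "S \<subseteq> nb i" "\<And>j. j \<in> S \<Longrightarrow> poly q (\<tau> i j) = 0" "degree q < card S" for q i S
  proof (rule poly_eq_0_if_many_roots)
    show "finite S" using that(2) fin_nb[OF that(1)] finite_subset by blast
    show "inj_on (\<tau> i) S" unfolding \<tau>_def using inj[OF that(1)] that(2) by (rule inj_on_subset)
  qed (use that in auto)
  have pd: "pderiv (ev e i) = ev (dX e) i + smult (s i) (ev (dY e) i) + smult ((s i)\<^sup>2) (ev (dZ e) i)"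
    if "supported E e" for e i
    unfolding ev_def by (rule pderiv_on_line[OF that])
  note pd1 = pd[OF sup1(1)] pd[OF sup1(2)] pd[OF sup1(3)]
  note pd2 = sup2[THEN pd]
  \<comment> \<open>P vanishes along line i, hence so does its derivative in the direction of the
    line. \<open>F1\<close>, \<open>F2\<close> and \<open>F3\<close> evaluate this identity and its
    first two derivatives.\<close>
  have F: "ev (dX c) i + smult (s i) (ev (dY c) i) + smult ((s i)\<^sup>2) (ev (dZ c) i) = 0" if "i \<in> L" for i
    using pd[OF sup, of i] c0[OF that] by simp
  have F1: "poly (ev (dX c) i) x + s i * poly (ev (dY c) i) x + (s i)\<^sup>2 * poly (ev (dZ c) i) x = 0"
    if "i \<in> L" for i x
    using arg_cong[OF F[OF that], of "\<lambda>q. poly q x"] by simp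
  have F2: "poly (pderiv (ev (dX c) i)) x + s i * poly (pderiv (ev (dY c) i)) x
      + (s i)\<^sup>2 * poly (pderiv (ev (dZ c) i)) x = 0" if "i \<in> L" for i x
    using arg_cong[OF F[OF that], of "\<lambda>q. poly (pderiv q) x"] by (simp add: pderiv_add pderiv_smult)
  have F3: "poly (pderiv (pderiv (ev (dX c) i))) x + s i * poly (pderiv (pderiv (ev (dY c) i))) x
      + (s i)\<^sup>2 * poly (pderiv (pderiv (ev (dZ c) i))) x = 0" if "i \<in> L" for i x
    using arg_cong[OF F[OF that], of "\<lambda>q. poly (pderiv (pderiv q)) x"] by (simp add: pderiv_add pderiv_smult)
  define U where "U = ev (dY c)"
  define W where "W = ev (dZ c)"
  have U_cross: "poly (U i) (\<tau> i j) = - (s i + s j) * poly (W i) (\<tau> i j)" if "i \<in> L" "j \<in> nb i" for i j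
  proof -
    have j: "j \<in> L" using nb_sub that by blast
    \<comment> \<open>Subtracting the quadratic equations for the two slopes eliminates P_X.
      Dividing by \<open>s i - s j\<close> leaves Vieta's formula for the sum of the roots.\<close>
    have "(s i - s j) * (poly (U i) (\<tau> i j) + (s i + s j) * poly (W i) (\<tau> i j)) = 0"
      using F1[OF that(1), of "\<tau> i j"] F1[OF j, of "\<tau> i j"]
      unfolding U_def W_def cross[OF that] by Groebner_Basis.algebra
    then have "poly (U i) (\<tau> i j) + (s i + s j) * poly (W i) (\<tau> i j) = 0"
      using meet[OF that] by (metis mult_eq_0_iff right_minus_eq)
    then show ?thesis by Groebner_Basis.algebra
  qed
  \<comment> \<open>If P_Z vanished on all lines, then so would P_Y by its many zeros and P_X by
    \<open>F\<close>. Minimality of E makes all three partials zero, so P is constant, against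
    minimality again.\<close>
  have "\<exists>i\<in>L. W i \<noteq> 0"
  proof (rule ccontr)
    assume "\<not> (\<exists>i\<in>L. W i \<noteq> 0)"
    then have W0: "W i = 0" if "i \<in> L" for i using that by blast
    have U0: "U i = 0" if "i \<in> L" for i
    proof (rule many[OF that order_refl])
      show "degree (U i) < card (nb i)"
        using rich[OF that] deg[of "dY c" i] E_le unfolding U_def by linarith
    qed (use U_cross W0 that in auto)
    have X0: "ev (dX c) i = 0" if "i \<in> L" for i
      using F[OF that] U0[OF that] W0[OF that] by (simp add: U_def W_def)
    have E_pos: "E > 0"
    proof (rule ccontr)
      assume "\<not> E > 0"
      then have E0: "E = 0" by simp
      have s0: "simplex 0 = {(0, 0, 0)}" by (auto simp: simplex_def)
      have "c (0, 0, 0) = 0"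
        using c ne unfolding vanishing_def E0 on_line_def tri_poly_def s0 by auto
      then have "c e = 0" for e
        using sup unfolding supported_def E0 s0 by (metis singletonD)
      then have "c = (\<lambda>_. 0)" by blast
      then show False using c by (simp add: vanishing_def)
    qed
    have zero: "e = (\<lambda>_. 0)" if "supported (E - 1) e" "\<And>i. i \<in> L \<Longrightarrow> ev e i = 0" for e
    proof (rule ccontr)
      assume "e \<noteq> (\<lambda>_. 0)"
      then have "vanishing (E - 1) e"
        using that tri_poly_supported[OF that(1), of E] unfolding vanishing_def ev_def on_line_def by simp
      then show False using minimal[of "E - 1"] E_pos by simp
    qed
    have dz: "dX c = (\<lambda>_. 0)" "dY c = (\<lambda>_. 0)" "dZ c = (\<lambda>_. 0)"
      using zero[OF supported_partials(1)[OF sup]] zero[OF supported_partials(2)[OF sup]]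
        zero[OF supported_partials(3)[OF sup]] X0 U0 W0 unfolding U_def W_def by blast+
    \<comment> \<open>Positive exponents up to E are invertible in the field, so zero partials kill
      every coefficient but the constant one.\<close>
    have "c e = 0" if "e \<noteq> (0, 0, 0)" for e
    proof (cases "e \<in> simplex E")
      case True
      obtain a1 a2 a3 where e: "e = (a1, a2, a3)" by (cases e)
      have le: "a1 + a2 + a3 \<le> E" using True by (simp add: e simplex_def)
      have "a1 \<noteq> 0 \<or> a2 \<noteq> 0 \<or> a3 \<noteq> 0" using that e by simp
      moreover have "c e = 0" if "a1 \<noteq> 0"
      proof -
        have "of_nat a1 * c (a1, a2, a3) = 0"
          using fun_cong[OF dz(1), of "(a1 - 1, a2, a3)"] that by (simp add: dX_def)
        then show ?thesis using char[of a1] le E_le that e by auto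
      qed
      moreover have "c e = 0" if "a2 \<noteq> 0"
      proof -
        have "of_nat a2 * c (a1, a2, a3) = 0"
          using fun_cong[OF dz(2), of "(a1, a2 - 1, a3)"] that by (simp add: dY_def)
        then show ?thesis using char[of a2] le E_le that e by auto
      qed
      moreover have "c e = 0" if "a3 \<noteq> 0"
      proof -
        have "of_nat a3 * c (a1, a2, a3) = 0"
          using fun_cong[OF dz(3), of "(a1, a2, a3 - 1)"] that by (simp add: dZ_def)
        then show ?thesis using char[of a3] le E_le that e by auto
      qed
      ultimately show ?thesis by blast
    next
      case False
      then show ?thesis using sup unfolding supported_def by blast
    qed
    then have "supported 0 c" by (auto simp: supported_def simplex_def)
    moreover from this have "vanishing 0 c"
      using c tri_poly_supported[OF \<open>supported 0 c\<close>, of E] unfolding vanishing_def on_line_def by simp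
    ultimately show False using minimal E_pos by blast
  qed
  then obtain i where i: "i \<in> L" "W i \<noteq> 0" by blast
  \<comment> \<open>At a crossing with nonzero \<open>W i\<close>, the quotient
    \<open>R i / W i\<close> is the slope \<open>s j\<close>. \<open>J\<close> is the Hessian form
    at the null direction of slope R / W, multiplied by W^4 to clear denominators.\<close>
  define R where "R i = - (U i + smult (s i) (W i))" for i
  define J where "J i = ev (dX (dX c)) i * W i ^ 4 + smult 2 (ev (dX (dY c)) i * W i ^ 3 * R i)
    + (smult 2 (ev (dX (dZ c)) i) + ev (dY (dY c)) i) * W i ^ 2 * R i ^ 2
    + smult 2 (ev (dY (dZ c)) i * W i * R i ^ 3) + ev (dZ (dZ c)) i * R i ^ 4" for i
  have R_cross: "poly (R i) (\<tau> i j) = s j * poly (W i) (\<tau> i j)" if "i \<in> L" "j \<in> nb i" for i j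
    using U_cross[OF that] unfolding R_def poly_minus poly_add poly_smult by Groebner_Basis.algebra
  have J0: "J i = 0" if "i \<in> L" for i
  proof (rule many[OF that order_refl])
    fix j assume j: "j \<in> nb i"
    then have jL: "j \<in> L" using nb_sub that by blast
    let ?t = "\<tau> i j"
    \<comment> \<open>This is the second derivative of P along the crossing line j, taken at the
      crossing point.\<close>
    have H: "poly (ev (dX (dX c)) i) ?t + 2 * s j * poly (ev (dX (dY c)) i) ?t
        + (s j)\<^sup>2 * (2 * poly (ev (dX (dZ c)) i) ?t + poly (ev (dY (dY c)) i) ?t)
        + 2 * (s j) ^ 3 * poly (ev (dY (dZ c)) i) ?t + (s j) ^ 4 * poly (ev (dZ (dZ c)) i) ?t = 0"
      using F2[OF jL, of ?t] unfolding pd1 partials_commute cross[OF that j]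
      by (simp add: algebra_simps power2_eq_square power3_eq_cube power4_eq_xxxx)
    have "poly (J i) ?t = poly (W i) ?t ^ 4 * (poly (ev (dX (dX c)) i) ?t + 2 * s j * poly (ev (dX (dY c)) i) ?t
        + (s j)\<^sup>2 * (2 * poly (ev (dX (dZ c)) i) ?t + poly (ev (dY (dY c)) i) ?t)
        + 2 * (s j) ^ 3 * poly (ev (dY (dZ c)) i) ?t + (s j) ^ 4 * poly (ev (dZ (dZ c)) i) ?t)"
      unfolding J_def poly_add poly_mult poly_smult poly_power R_cross[OF that j] by Groebner_Basis.algebra
    then show "poly (J i) ?t = 0" using H by simp
  next
    have degW: "degree (W i) \<le> E" and degR: "degree (R i) \<le> E"
      unfolding R_def U_def W_def degree_minus using deg by (auto intro!: degree_add_le order_trans[OF degree_smult_le])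
    have deg_term: "degree (q * W i ^ k * R i ^ l) \<le> 5 * E" if "degree q \<le> E" "k + l = 4" for q k l
    proof -
      have "degree (q * W i ^ k * R i ^ l) \<le> degree q + degree (W i ^ k) + degree (R i ^ l)"
        by (meson add_le_mono1 degree_mult_le order_trans)
      also have "\<dots> \<le> E + E * k + E * l"
        using that(1) degW degR by (intro add_mono order_trans[OF degree_power_le] mult_right_mono) auto
      also have "\<dots> = 5 * E" unfolding add.assoc add_mult_distrib2[symmetric] that(2) by simp
      finally show ?thesis .
    qed
    have "degree (J i) \<le> 5 * E"
      unfolding J_def
      using deg_term[of "ev (dX (dX c)) i" 4 0] deg_term[of "ev (dX (dY c)) i" 3 1]
        deg_term[of "smult 2 (ev (dX (dZ c)) i) + ev (dY (dY c)) i" 2 2]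
        deg_term[of "ev (dY (dZ c)) i" 1 3] deg_term[of "ev (dZ (dZ c)) i" 0 4] deg
      by (auto intro!: degree_add_le order_trans[OF degree_smult_le])
    then show "degree (J i) < card (nb i)"
      using rich[OF that] E_le by linarith
  qed
  define w where "w = W i"
  \<comment> \<open>Here \<open>v\<close> is \<open>R i - s i * w\<close>, so w / v takes the value
    1 / (s j - s i) at crossings with w nonzero, and \<open>g\<close> is v^2 times its
    derivative.\<close>
  define v where "v = - (U i + smult (2 * s i) w)"
  define g where "g = pderiv w * v - w * pderiv v"
  define S where "S = {j \<in> nb i. poly w (\<tau> i j) \<noteq> 0}"
  have S: "S \<subseteq> nb i" "finite S" using fin_nb[OF i(1)] by (auto simp: S_def)
  have degw: "degree w \<le> E" and degv: "degree v \<le> E"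
    unfolding v_def w_def U_def W_def degree_minus using deg by (auto intro!: degree_add_le order_trans[OF degree_smult_le])
  have cardS: "12 * m + n < card S"
  proof -
    have "card (nb i - S) \<le> degree w"
    proof (rule ccontr)
      assume "\<not> ?thesis"
      then have "w = 0"
        by (intro many[OF i(1), of "nb i - S"]) (auto simp: S_def)
      then show False using i(2) by (simp add: w_def)
    qed
    moreover have "card (nb i) = card S + card (nb i - S)"
      using S by (metis card_Diff_subset card_mono fin_nb[OF i(1)] le_add_diff_inverse)
    ultimately show ?thesis using rich[OF i(1)] degw E_le by linarith
  qed
  have v_cross: "poly v (\<tau> i j) = (s j - s i) * poly w (\<tau> i j)" if "j \<in> nb i" for j
    using U_cross[OF i(1) that] unfolding v_def w_def poly_minus poly_add poly_smult by Groebner_Basis.algebra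
  have "v \<noteq> 0"
  proof
    assume "v = 0"
    obtain j where "j \<in> S" using cardS by (metis card.empty equals0I not_less0)
    then show False
      using v_cross[of j] \<open>v = 0\<close> meet[OF i(1), of j] by (auto simp: S_def)
  qed
  have degp: "degree (pderiv q) \<le> E" if "degree q \<le> E" for q :: "'a poly"
    using that by (intro degree_le) (auto simp: coeff_pderiv coeff_eq_0)
  have degg: "degree g \<le> 2 * E"
    unfolding g_def using degp[OF degw] degp[OF degv] degw degv
    by (intro degree_diff_le order_trans[OF degree_mult_le]) linarith+
  \<comment> \<open>The left side is v^3 times the second derivative of w / v. Its degree is at most
    3 * E, hence at most 9 * m, which is below the number of crossings in S.\<close>
  have ode: "pderiv g * v - smult 2 (pderiv v * g) = 0"
  proof (rule many[OF i(1) S(1)])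
    fix j assume "j \<in> S"
    then have j: "j \<in> nb i" and wj: "poly w (\<tau> i j) \<noteq> 0" by (auto simp: S_def)
    then have jL: "j \<in> L" using nb_sub i by blast
    let ?t = "\<tau> i j"
    have iw: "pderiv w = ev (dX (dZ c)) i + smult (s i) (ev (dY (dZ c)) i) + smult ((s i)\<^sup>2) (ev (dZ (dZ c)) i)"
      unfolding w_def W_def pd1 ..
    have iu: "pderiv (U i) = ev (dX (dY c)) i + smult (s i) (ev (dY (dY c)) i) + smult ((s i)\<^sup>2) (ev (dY (dZ c)) i)"
      unfolding U_def pd1 partials_commute ..
    have jw: "pderiv (W j) = ev (dX (dZ c)) j + smult (s j) (ev (dY (dZ c)) j) + smult ((s j)\<^sup>2) (ev (dZ (dZ c)) j)"
      unfolding W_def pd1 ..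
    have ju: "pderiv (U j) = ev (dX (dY c)) j + smult (s j) (ev (dY (dY c)) j) + smult ((s j)\<^sup>2) (ev (dY (dZ c)) j)"
      unfolding U_def pd1 partials_commute ..
    have Wj: "poly (W j) ?t = poly w ?t"
      using cross[OF i(1) j, of "dZ c"] by (simp add: w_def W_def)
    \<comment> \<open>The roles are exchanged: seen from line j, the crossing line is i, so the
      rational slope function of j takes the value \<open>s i\<close>.\<close>
    have Rj: "poly (R j) ?t = s i * poly w ?t"
      using R_cross[OF jL nb_sym[OF i(1) j]] \<tau>_sym[of j i] Wj by simp
    have "(poly (pderiv (pderiv w)) ?t * poly v ?t - poly w ?t * poly (pderiv (pderiv v)) ?t) * poly v ?t
        - 2 * poly (pderiv v) ?t * (poly (pderiv w) ?t * poly v ?t - poly w ?t * poly (pderiv v) ?t) = 0"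
    proof (rule crossing_identity[where s = "s i" and t = "s j" and w = "poly w ?t"
          and XX = "poly (ev (dX (dX c)) i) ?t" and XY = "poly (ev (dX (dY c)) i) ?t"
          and XZ = "poly (ev (dX (dZ c)) i) ?t" and YY = "poly (ev (dY (dY c)) i) ?t"
          and YZ = "poly (ev (dY (dZ c)) i) ?t" and ZZ = "poly (ev (dZ (dZ c)) i) ?t"
          and XXX = "poly (ev (dX (dX (dX c))) i) ?t" and XXY = "poly (ev (dX (dX (dY c))) i) ?t"
          and XXZ = "poly (ev (dX (dX (dZ c))) i) ?t" and XYY = "poly (ev (dX (dY (dY c))) i) ?t"
          and XYZ = "poly (ev (dX (dY (dZ c))) i) ?t" and XZZ = "poly (ev (dX (dZ (dZ c))) i) ?t"
          and YYY = "poly (ev (dY (dY (dY c))) i) ?t" and YYZ = "poly (ev (dY (dY (dZ c))) i) ?t"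
          and YZZ = "poly (ev (dY (dZ (dZ c))) i) ?t" and ZZZ = "poly (ev (dZ (dZ (dZ c))) i) ?t"
          and ?u1.0 = "poly (pderiv (U i)) ?t" and ?w1.0 = "poly (pderiv w) ?t"
          and ?b1.0 = "poly (pderiv (U j)) ?t" and ?d1.0 = "poly (pderiv (W j)) ?t"
          and ?u2.0 = "poly (pderiv (pderiv (U i))) ?t" and ?w2.0 = "poly (pderiv (pderiv w)) ?t"])
      show "s i \<noteq> s j" using meet[OF i(1) j] by simp
      show "poly w ?t \<noteq> 0" by (rule wj)
      show "poly (pderiv w) ?t = poly (ev (dX (dZ c)) i) ?t + s i * poly (ev (dY (dZ c)) i) ?t
          + (s i)\<^sup>2 * poly (ev (dZ (dZ c)) i) ?t"
        unfolding iw by simp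
      show "poly (pderiv (U i)) ?t = poly (ev (dX (dY c)) i) ?t + s i * poly (ev (dY (dY c)) i) ?t
          + (s i)\<^sup>2 * poly (ev (dY (dZ c)) i) ?t"
        unfolding iu by simp
      show "poly (pderiv (W j)) ?t = poly (ev (dX (dZ c)) i) ?t + s j * poly (ev (dY (dZ c)) i) ?t
          + (s j)\<^sup>2 * poly (ev (dZ (dZ c)) i) ?t"
        unfolding jw by (simp add: cross[OF i(1) j])
      show "poly (pderiv (U j)) ?t = poly (ev (dX (dY c)) i) ?t + s j * poly (ev (dY (dY c)) i) ?t
          + (s j)\<^sup>2 * poly (ev (dY (dZ c)) i) ?t"
        unfolding ju by (simp add: cross[OF i(1) j])
      show "poly v ?t = (s j - s i) * poly w ?t" by (rule v_cross[OF j])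
      show "poly (pderiv v) ?t = - (poly (pderiv (U i)) ?t + 2 * s i * poly (pderiv w) ?t)"
        unfolding v_def by (simp add: pderiv_add pderiv_smult pderiv_minus pderiv_diff)
      show "poly (pderiv (pderiv v)) ?t = - (poly (pderiv (pderiv (U i))) ?t + 2 * s i * poly (pderiv (pderiv w)) ?t)"
        unfolding v_def by (simp add: pderiv_add pderiv_smult pderiv_minus pderiv_diff)
      show "poly (ev (dX (dX c)) i) ?t + s i * poly (ev (dX (dY c)) i) ?t + (s i)\<^sup>2 * poly (ev (dX (dZ c)) i) ?t
        + s i * (poly (ev (dX (dY c)) i) ?t + s i * poly (ev (dY (dY c)) i) ?t + (s i)\<^sup>2 * poly (ev (dY (dZ c)) i) ?t)
        + (s i)\<^sup>2 * (poly (ev (dX (dZ c)) i) ?t + s i * poly (ev (dY (dZ c)) i) ?t + (s i)\<^sup>2 * poly (ev (dZ (dZ c)) i) ?t) = 0"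
        using F2[OF i(1), of ?t] unfolding pd1 partials_commute by simp
      show "poly (ev (dX (dX c)) i) ?t + s j * poly (ev (dX (dY c)) i) ?t + (s j)\<^sup>2 * poly (ev (dX (dZ c)) i) ?t
        + s j * (poly (ev (dX (dY c)) i) ?t + s j * poly (ev (dY (dY c)) i) ?t + (s j)\<^sup>2 * poly (ev (dY (dZ c)) i) ?t)
        + (s j)\<^sup>2 * (poly (ev (dX (dZ c)) i) ?t + s j * poly (ev (dY (dZ c)) i) ?t + (s j)\<^sup>2 * poly (ev (dZ (dZ c)) i) ?t) = 0"
        using F2[OF jL, of ?t] unfolding pd1 partials_commute by (simp add: cross[OF i(1) j])
      show "poly (pderiv (pderiv (U i))) ?t =
          poly (ev (dX (dX (dY c))) i) ?t + s i * poly (ev (dX (dY (dY c))) i) ?t + (s i)\<^sup>2 * poly (ev (dX (dY (dZ c))) i) ?t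
          + s i * (poly (ev (dX (dY (dY c))) i) ?t + s i * poly (ev (dY (dY (dY c))) i) ?t + (s i)\<^sup>2 * poly (ev (dY (dY (dZ c))) i) ?t)
          + (s i)\<^sup>2 * (poly (ev (dX (dY (dZ c))) i) ?t + s i * poly (ev (dY (dY (dZ c))) i) ?t + (s i)\<^sup>2 * poly (ev (dY (dZ (dZ c))) i) ?t)"
        unfolding U_def pd1 by (simp add: pderiv_add pderiv_smult pd2 partials_commute)
      show "poly (pderiv (pderiv w)) ?t =
          poly (ev (dX (dX (dZ c))) i) ?t + s i * poly (ev (dX (dY (dZ c))) i) ?t + (s i)\<^sup>2 * poly (ev (dX (dZ (dZ c))) i) ?t
          + s i * (poly (ev (dX (dY (dZ c))) i) ?t + s i * poly (ev (dY (dY (dZ c))) i) ?t + (s i)\<^sup>2 * poly (ev (dY (dZ (dZ c))) i) ?t)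
          + (s i)\<^sup>2 * (poly (ev (dX (dZ (dZ c))) i) ?t + s i * poly (ev (dY (dZ (dZ c))) i) ?t + (s i)\<^sup>2 * poly (ev (dZ (dZ (dZ c))) i) ?t)"
        unfolding w_def W_def pd1 by (simp add: pderiv_add pderiv_smult pd2 partials_commute)
      show "poly (ev (dX (dX (dX c))) i) ?t + s i * poly (ev (dX (dX (dY c))) i) ?t + (s i)\<^sup>2 * poly (ev (dX (dX (dZ c))) i) ?t
          + s i * (poly (ev (dX (dX (dY c))) i) ?t + s i * poly (ev (dX (dY (dY c))) i) ?t + (s i)\<^sup>2 * poly (ev (dX (dY (dZ c))) i) ?t)
          + (s i)\<^sup>2 * (poly (ev (dX (dX (dZ c))) i) ?t + s i * poly (ev (dX (dY (dZ c))) i) ?t + (s i)\<^sup>2 * poly (ev (dX (dZ (dZ c))) i) ?t)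
          + s i * poly (pderiv (pderiv (U i))) ?t + (s i)\<^sup>2 * poly (pderiv (pderiv w)) ?t = 0"
        using F3[OF i(1), of ?t] unfolding U_def w_def W_def pd1(1)
        by (simp add: pderiv_add pderiv_smult pd2 partials_commute)
      \<comment> \<open>\<open>J j\<close> is zero as a polynomial along line j, so it may be
        differentiated along j at the crossing. This yields the hypothesis \<open>J\<close> of
        \<open>crossing_identity\<close>.\<close>
      have J1: "poly (pderiv (J j)) ?t = 0" by (simp add: J0[OF jL])
      have R1: "poly (pderiv (R j)) ?t = - (poly (pderiv (U j)) ?t + s j * poly (pderiv (W j)) ?t)"
        unfolding R_def by (simp add: pderiv_add pderiv_smult pderiv_minus pderiv_diff)
      have powers: "poly (pderiv (q ^ 4)) ?t = 4 * poly q ?t ^ 3 * poly (pderiv q) ?t"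
        "poly (pderiv (q ^ 3)) ?t = 3 * poly q ?t ^ 2 * poly (pderiv q) ?t"
        "poly (pderiv (q ^ 2)) ?t = 2 * poly q ?t * poly (pderiv q) ?t" for q
        by (simp_all add: pderiv_power)
      show "poly w ?t ^ 4 * ((poly (ev (dX (dX (dX c))) i) ?t + s j * poly (ev (dX (dX (dY c))) i) ?t + (s j)\<^sup>2 * poly (ev (dX (dX (dZ c))) i) ?t)
          + 2 * s i * (poly (ev (dX (dX (dY c))) i) ?t + s j * poly (ev (dX (dY (dY c))) i) ?t + (s j)\<^sup>2 * poly (ev (dX (dY (dZ c))) i) ?t)
          + (s i)\<^sup>2 * (2 * (poly (ev (dX (dX (dZ c))) i) ?t + s j * poly (ev (dX (dY (dZ c))) i) ?t + (s j)\<^sup>2 * poly (ev (dX (dZ (dZ c))) i) ?t)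
            + (poly (ev (dX (dY (dY c))) i) ?t + s j * poly (ev (dY (dY (dY c))) i) ?t + (s j)\<^sup>2 * poly (ev (dY (dY (dZ c))) i) ?t))
          + 2 * (s i) ^ 3 * (poly (ev (dX (dY (dZ c))) i) ?t + s j * poly (ev (dY (dY (dZ c))) i) ?t + (s j)\<^sup>2 * poly (ev (dY (dZ (dZ c))) i) ?t)
          + (s i) ^ 4 * (poly (ev (dX (dZ (dZ c))) i) ?t + s j * poly (ev (dY (dZ (dZ c))) i) ?t + (s j)\<^sup>2 * poly (ev (dZ (dZ (dZ c))) i) ?t))
        + poly w ?t ^ 3 * (poly (pderiv (W j)) ?t * (4 * poly (ev (dX (dX c)) i) ?t + 6 * s i * poly (ev (dX (dY c)) i) ?t
            + 2 * (s i)\<^sup>2 * (2 * poly (ev (dX (dZ c)) i) ?t + poly (ev (dY (dY c)) i) ?t) + 2 * (s i) ^ 3 * poly (ev (dY (dZ c)) i) ?t)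
          - (poly (pderiv (U j)) ?t + s j * poly (pderiv (W j)) ?t) * (2 * poly (ev (dX (dY c)) i) ?t
            + 2 * s i * (2 * poly (ev (dX (dZ c)) i) ?t + poly (ev (dY (dY c)) i) ?t) + 6 * (s i)\<^sup>2 * poly (ev (dY (dZ c)) i) ?t
            + 4 * (s i) ^ 3 * poly (ev (dZ (dZ c)) i) ?t)) = 0"
        using J1 unfolding J_def
        by (simp only: powers R1 pderiv_add pderiv_smult pderiv_mult pd2 partials_commute
            poly_add poly_mult poly_smult poly_power Wj Rj cross[OF i(1) j, symmetric]) Groebner_Basis.algebra
    qed
    then show "poly (pderiv g * v - smult 2 (pderiv v * g)) ?t = 0"
      unfolding g_def by (simp add: pderiv_diff pderiv_mult algebra_simps)
  next
    have "degree (pderiv g) \<le> 2 * E"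
      using degg by (intro degree_le) (auto simp: coeff_pderiv coeff_eq_0)
    then have "degree (pderiv g * v - smult 2 (pderiv v * g)) \<le> 3 * E"
      using degp[OF degv] degv degg
      by (intro degree_diff_le order_trans[OF degree_smult_le] order_trans[OF degree_mult_le]) linarith+
    then show "degree (pderiv g * v - smult 2 (pderiv v * g)) < card S"
      using cardS E_le by linarith
  qed
  obtain k where k: "g = smult k (v * v)"
  proof (rule wronskian_zero_imp_proportional[OF char])
    show "degree g \<le> 6 * m + 2" using degg E_le by linarith
    show "degree (v * v) \<le> 6 * m + 2" using degree_mult_le[of v v] degv E_le by linarith
    show "v * v \<noteq> 0" using \<open>v \<noteq> 0\<close> by simp
    \<comment> \<open>Multiplied by v, the equation says that the Wronskian of g and v^2
      vanishes.\<close>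
    have "v * (pderiv g * v - smult 2 (pderiv v * g)) = 0" using ode by simp
    moreover have "smult 2 q = q + q" for q :: "'a poly"
      by (metis one_add_one smult_1_left smult_add_left)
    ultimately show "pderiv g * (v * v) = g * pderiv (v * v)"
      by (simp add: pderiv_mult algebra_simps)
  qed
  \<comment> \<open>Now (w / v)' = k, so w / v minus k times the parameter is constant.\<close>
  obtain a where a: "w - smult k ([:0, 1:] * v) = smult a v"
  proof (rule wronskian_zero_imp_proportional[OF char])
    have "degree ([:0, 1:] * v) \<le> E + 1"
      using degree_mult_le[of "[:0, 1:]" v] degv by simp
    then show "degree (w - smult k ([:0, 1:] * v)) \<le> 6 * m + 2"
      using degw E_le by (intro degree_diff_le order_trans[OF degree_smult_le]) linarith+
    show "degree v \<le> 6 * m + 2" using degv E_le by linarith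
    show "v \<noteq> 0" by (rule \<open>v \<noteq> 0\<close>)
    have p: "pderiv ([:0, 1:] * v) = v + [:0, 1:] * pderiv v"
      by (simp only: pderiv_mult) (simp add: pderiv_pCons)
    have "pderiv w * v - w * pderiv v = smult k (v * v)" using k by (simp add: g_def)
    then show "pderiv (w - smult k ([:0, 1:] * v)) * v = (w - smult k ([:0, 1:] * v)) * pderiv v"
      unfolding pderiv_diff pderiv_smult p
      by (simp add: ring_distribs smult_add_right mult.assoc) (simp add: algebra_simps)
  qed
  have "S \<subseteq> {j \<in> nb i. a * (s j - s i) - k * (b j - b i) = 1}"
  proof
    fix j assume "j \<in> S"
    then have j: "j \<in> nb i" and wj: "poly w (\<tau> i j) \<noteq> 0" by (auto simp: S_def)
    let ?t = "\<tau> i j"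
    \<comment> \<open>Inserting the known value of v into w = (k x + a) v and eliminating the
      crossing parameter leaves an equation that is linear in the slope and offset of line
      j.\<close>
    have "poly w ?t = (k * ?t + a) * ((s j - s i) * poly w ?t)"
      using arg_cong[OF a, of "\<lambda>q. poly q ?t"] v_cross[OF j] by (simp add: algebra_simps)
    then have "(k * ?t + a) * (s j - s i) = 1"
      using wj by (metis mult.assoc mult_cancel_right1)
    moreover have "?t * (s i - s j) = b j - b i"
      using meet[OF i(1) j] by (simp add: \<tau>_def)
    ultimately have "a * (s j - s i) - k * (b j - b i) = 1"
      by Groebner_Basis.algebra
    then show "j \<in> {j \<in> nb i. a * (s j - s i) - k * (b j - b i) = 1}" using j by simp
  qed
  then have "card S \<le> card {j \<in> nb i. a * (s j - s i) - k * (b j - b i) = 1}"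
    using fin_nb[OF i(1)] by (intro card_mono) auto
  then show False
    using pencil[OF i(1), of a k] cardS by linarith
qed

section \<open>Growth of sums of squares\<close>

text \<open>A graph of average degree above 2 K contains a subgraph of minimum degree above K. In a
  smallest vertex set that is still dense, deleting a vertex of degree at most K would lower the
  degree sum by at most 2 K and the required bound by exactly 2 K.\<close>

lemma min_degree_subset:
  fixes nb :: "'i \<Rightarrow> 'i set"
  assumes fin: "finite L0" and sym: "\<And>i j. j \<in> nb i \<Longrightarrow> i \<in> nb j" and irr: "\<And>i. i \<notin> nb i"
    and big: "2 * K * card L0 < (\<Sum>i\<in>L0. card (nb i \<inter> L0))"
  obtains L where "L \<subseteq> L0" "L \<noteq> {}" "\<And>i. i \<in> L \<Longrightarrow> K < card (nb i \<inter> L)"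
proof -
  define dense where "dense L \<longleftrightarrow> L \<subseteq> L0 \<and> 2 * K * card L < (\<Sum>i\<in>L. card (nb i \<inter> L))" for L
  obtain L where L: "dense L" and least: "\<And>M. dense M \<Longrightarrow> card L \<le> card M"
  proof -
    have "dense L0" using big by (simp add: dense_def)
    from ex_has_least_nat[of dense L0 card, OF this] show ?thesis using that by blast
  qed
  have finL: "finite L" using L fin by (auto simp: dense_def intro: finite_subset)
  have "K < card (nb i \<inter> L)" if i: "i \<in> L" for i
  proof (rule ccontr)
    assume small: "\<not> K < card (nb i \<inter> L)"
    let ?M = "L - {i}"
    have split: "card (nb j \<inter> L) = card (nb j \<inter> ?M) + (if i \<in> nb j then 1 else 0)" for j
    proof (cases "i \<in> nb j")
      case True
      then have "nb j \<inter> L = insert i (nb j \<inter> ?M)" using i by blast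
      then show ?thesis using finL True by simp
    next
      case False
      then have "nb j \<inter> L = nb j \<inter> ?M" by blast
      then show ?thesis using False by simp
    qed
    have "(\<Sum>j\<in>?M. if i \<in> nb j then 1 else 0) = card {j \<in> ?M. i \<in> nb j}"
      using finL by (simp add: sum.If_cases Int_def)
    also have "{j \<in> ?M. i \<in> nb j} = nb i \<inter> L"
    proof -
      have "j \<in> {j \<in> ?M. i \<in> nb j} \<longleftrightarrow> j \<in> nb i \<inter> L" for j
        using sym[of i j] sym[of j i] irr[of i] by (cases "j = i") auto
      then show ?thesis by blast
    qed
    finally have degree_i: "(\<Sum>j\<in>?M. if i \<in> nb j then 1 else 0) = card (nb i \<inter> L)" .
    have "(\<Sum>j\<in>L. card (nb j \<inter> L)) = card (nb i \<inter> L) + (\<Sum>j\<in>?M. card (nb j \<inter> L))"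
      using finL i by (rule sum.remove)
    also have "(\<Sum>j\<in>?M. card (nb j \<inter> L)) = (\<Sum>j\<in>?M. card (nb j \<inter> ?M)) + card (nb i \<inter> L)"
      unfolding split sum.distrib degree_i ..
    finally have "(\<Sum>j\<in>L. card (nb j \<inter> L)) \<le> (\<Sum>j\<in>?M. card (nb j \<inter> ?M)) + 2 * K"
      using small by linarith
    moreover have "2 * K * card L = 2 * K * card ?M + 2 * K"
      using card.remove[OF finL i] by simp
    ultimately have "dense ?M"
      using L unfolding dense_def by auto
    then show False
      using least[of ?M] card_Diff1_less[OF finL i] by linarith
  qed
  moreover have "L \<noteq> {}" using L by (auto simp: dense_def)
  moreover have "L \<subseteq> L0" using L by (simp add: dense_def)
  ultimately show thesis using that by blast
qed

text \<open>Cauchy-Schwarz over the fibres of f, whose squared sizes count the pairs with equal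
  values.\<close>

lemma sum_card_squared_le:
  assumes "finite S" and "finite T" and "f ` S \<subseteq> T"
  shows "(card S)\<^sup>2 \<le> card T * card {(x, y) \<in> S \<times> S. f x = f y}"
proof -
  let ?r = "\<lambda>t. card {x \<in> S. f x = t}"
  have "card S = (\<Sum>t\<in>T. ?r t)"
  proof -
    have "(\<Union>t\<in>T. {x \<in> S. f x = t}) = S" using assms(3) by auto
    moreover have "card (\<Union>t\<in>T. {x \<in> S. f x = t}) = (\<Sum>t\<in>T. ?r t)"
      using assms by (intro card_UN_disjoint) auto
    ultimately show ?thesis by (rule subst)
  qed
  moreover have "card {(x, y) \<in> S \<times> S. f x = f y} = (\<Sum>t\<in>T. (?r t)\<^sup>2)"
  proof -
    have "{(x, y) \<in> S \<times> S. f x = f y} = (\<Union>t\<in>T. {x \<in> S. f x = t} \<times> {x \<in> S. f x = t})"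
      using assms(3) by auto
    also have "card \<dots> = (\<Sum>t\<in>T. card ({x \<in> S. f x = t} \<times> {x \<in> S. f x = t}))"
      using assms by (intro card_UN_disjoint) auto
    finally show ?thesis by (simp add: card_cartesian_product power2_eq_square)
  qed
  moreover have "(\<Sum>t\<in>T. ?r t)\<^sup>2 \<le> card T * (\<Sum>t\<in>T. (?r t)\<^sup>2)"
  proof -
    have "real ((\<Sum>t\<in>T. ?r t)\<^sup>2) \<le> real (card T * (\<Sum>t\<in>T. (?r t)\<^sup>2))"
      using sum_squared_le_sum_of_squares[of "\<lambda>t. real (?r t)" T] by (simp add: mult.commute)
    then show ?thesis by (simp only: of_nat_le_iff)
  qed
  ultimately show ?thesis by simp
qed

section \<open>Incidences between triples\<close>

text \<open>The lines of \<open>(x, y, z)\<close> of the first and second kind have slopes \<open>2 * \<mu> * x\<close> and \<open>2 * x\<close> and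
  offsets \<open>y\<close> and \<open>y / \<mu>\<close>. A line of the first kind meets one of the second kind exactly if their triples are
  incident, and for most \<open>\<mu>\<close> few crossing points coincide.\<close>

definition incident :: "'a::field \<times> 'a \<times> 'a \<Rightarrow> 'a \<times> 'a \<times> 'a \<Rightarrow> bool" where
  "incident = (\<lambda>(x, y, z) (x', y', z'). (x - y')\<^sup>2 + z = (x' - y)\<^sup>2 + z')"

text \<open>Once one triple is fixed, incidence determines the third coordinate of the other from
  its first two.\<close>

lemma card_incident_le:
  fixes A B :: "'a::{field,finite} set"
  shows "card {r \<in> A \<times> A \<times> B. incident q r} \<le> (card A)\<^sup>2"
    and "card {q \<in> A \<times> A \<times> B. incident q r} \<le> (card A)\<^sup>2"
proof -
  have "inj_on (\<lambda>(x, y, z). (x, y)) {r \<in> A \<times> A \<times> B. incident q r}"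
    by (auto simp: inj_on_def incident_def split: prod.splits)
  then have "card {r \<in> A \<times> A \<times> B. incident q r} \<le> card (A \<times> A)"
    by (rule card_inj_on_le) auto
  then show "card {r \<in> A \<times> A \<times> B. incident q r} \<le> (card A)\<^sup>2"
    by (simp add: card_cartesian_product power2_eq_square)
  have "inj_on (\<lambda>(x, y, z). (x, y)) {q \<in> A \<times> A \<times> B. incident q r}"
    by (auto simp: inj_on_def incident_def split: prod.splits) (metis add_left_cancel)
  then have "card {q \<in> A \<times> A \<times> B. incident q r} \<le> card (A \<times> A)"
    by (rule card_inj_on_le) auto
  then show "card {q \<in> A \<times> A \<times> B. incident q r} \<le> (card A)\<^sup>2"
    by (simp add: card_cartesian_product power2_eq_square)
qed

text \<open>Cauchy-Schwarz counts pairs of triples with equal value of (x - y)^2 + z. Exchanging the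
  second coordinates within a pair turns equality of values into incidence.\<close>

lemma card_incidences_ge:
  fixes A B :: "'a::{field,finite} set"
  defines "Q \<equiv> A \<times> A \<times> B"
  defines "T \<equiv> {(x - y)\<^sup>2 + z | x y z. x \<in> A \<and> y \<in> A \<and> z \<in> B}"
  shows "(card Q)\<^sup>2 \<le> card T * card {(q, r) \<in> Q \<times> Q. incident q r}"
proof -
  define f :: "'a \<times> 'a \<times> 'a \<Rightarrow> 'a" where "f = (\<lambda>(x, y, z). (x - y)\<^sup>2 + z)"
  have "(card Q)\<^sup>2 \<le> card T * card {(q, r) \<in> Q \<times> Q. f q = f r}"
    by (rule sum_card_squared_le) (auto simp: f_def Q_def T_def)
  also have "card {(q, r) \<in> Q \<times> Q. f q = f r} = card {(q, r) \<in> Q \<times> Q. incident q r}"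
  proof (rule bij_betw_same_card)
    show "bij_betw (\<lambda>((x, y, z), (x', y', z')). ((x, y', z), (x', y, z')))
        {(q, r) \<in> Q \<times> Q. f q = f r} {(q, r) \<in> Q \<times> Q. incident q r}"
      by (rule bij_betw_byWitness[where f' = "\<lambda>((x, y, z), (x', y', z')). ((x, y', z), (x', y, z'))"])
        (auto simp: f_def incident_def Q_def)
  qed
  finally show ?thesis .
qed

text \<open>Given q and the first coordinate of r, degeneracy determines the second coordinate
  because that of q is divided by x, which is nonzero; incidence then determines the third. These
  pairs are set aside since the uniqueness lemmas for \<open>\<mu>\<close> assume
  nondegeneracy.\<close>

lemma card_degenerate_incidences_le:
  fixes A B :: "'a::{field,finite} set"
  assumes "0 \<notin> A"
  defines "Q \<equiv> A \<times> A \<times> B"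
  shows "card {(q, r) \<in> Q \<times> Q. incident q r \<and> fst (snd r) * fst q = fst r * fst (snd q)} \<le> card A * card Q"
proof -
  let ?S = "{(q, r) \<in> Q \<times> Q. incident q r \<and> fst (snd r) * fst q = fst r * fst (snd q)}"
  have "inj_on (\<lambda>(q, r). (q, fst r)) ?S"
  proof (rule inj_onI)
    fix e e' assume e: "e \<in> ?S" and e': "e' \<in> ?S"
      and eq: "(\<lambda>(q, r). (q, fst r)) e = (\<lambda>(q, r). (q, fst r)) e'"
    obtain x y z x' y' z' where E: "e = ((x, y, z), (x', y', z'))" by (metis prod.exhaust)
    obtain y'' z'' where E': "e' = ((x, y, z), (x', y'', z''))"
      using eq unfolding E by (cases e') auto
    have "x \<noteq> 0" using e assms(1) unfolding E Q_def by auto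
    moreover have "y' * x = y'' * x" using e e' unfolding E E' by simp
    ultimately have "y' = y''" by simp
    moreover from this have "z' = z''" using e e' unfolding E E' incident_def by simp
    ultimately show "e = e'" unfolding E E' by simp
  qed
  then have "card ?S \<le> card (Q \<times> A)"
    by (rule card_inj_on_le) (auto simp: Q_def)
  then show ?thesis by (simp add: card_cartesian_product mult.commute)
qed

section \<open>Choice of the scaling factor\<close>

text \<open>Equality of the parameters of two crossing points on one line, with denominators cleared.\<close>

definition same_crossing1 :: "'a::field \<Rightarrow> 'a \<times> 'a \<times> 'a \<Rightarrow> 'a \<times> 'a \<times> 'a \<Rightarrow> 'a \<times> 'a \<times> 'a \<Rightarrow> bool" where
  "same_crossing1 \<mu> = (\<lambda>(x, y, z) (x1, y1, z1) (x2, y2, z2).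
     (y1 - \<mu> * y) * (\<mu> * x - x2) = (y2 - \<mu> * y) * (\<mu> * x - x1))"

definition same_crossing2 :: "'a::field \<Rightarrow> 'a \<times> 'a \<times> 'a \<Rightarrow> 'a \<times> 'a \<times> 'a \<Rightarrow> 'a \<times> 'a \<times> 'a \<Rightarrow> bool" where
  "same_crossing2 \<mu> = (\<lambda>(x, y, z) (x1, y1, z1) (x2, y2, z2).
     (y - \<mu> * y1) * (\<mu> * x2 - x) = (y - \<mu> * y2) * (\<mu> * x1 - x))"

text \<open>The terms in \<open>\<mu>\<close> squared cancel, so the coincidence is a linear
  equation for \<open>\<mu>\<close>. Two solutions would force both of its coefficients to be 0, and
  nondegeneracy then identifies the two pairs.\<close>

lemma same_crossing1_unique:
  assumes "x \<noteq> 0" "y1 * x \<noteq> x1 * y" "(x1, y1) \<noteq> (x2, y2)"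
    and "same_crossing1 \<mu> (x, y, z) (x1, y1, z1) (x2, y2, z2)"
    and "same_crossing1 \<nu> (x, y, z) (x1, y1, z1) (x2, y2, z2)"
  shows "\<mu> = (\<nu>::'a::field)"
proof (rule ccontr)
  assume ne: "\<mu> \<noteq> \<nu>"
  define a where "a = x * (y1 - y2) - y * (x1 - x2)"
  have eq: "\<mu> * a = y1 * x2 - y2 * x1" "\<nu> * a = y1 * x2 - y2 * x1"
    using assms(4,5) unfolding same_crossing1_def a_def by (simp_all, Groebner_Basis.algebra+)
  then have "(\<mu> - \<nu>) * a = 0" by Groebner_Basis.algebra
  then have a: "a = 0" using ne by simp
  have "(x1 - x2) * (y1 * x - x1 * y) = 0"
    using a eq unfolding a_def by Groebner_Basis.algebra
  then have "x1 = x2" using assms(2) by simp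
  moreover from this have "y1 = y2" using a assms(1) unfolding a_def by simp
  ultimately show False using assms(3) by simp
qed

text \<open>Here the constant terms cancel instead, and division by the nonzero \<open>\<mu>\<close>
  again leaves a linear equation.\<close>

lemma same_crossing2_unique:
  assumes "x \<noteq> 0" "y * x1 \<noteq> x * y1" "(x1, y1) \<noteq> (x2, y2)" "\<mu> \<noteq> 0" "\<nu> \<noteq> 0"
    and "same_crossing2 \<mu> (x, y, z) (x1, y1, z1) (x2, y2, z2)"
    and "same_crossing2 \<nu> (x, y, z) (x1, y1, z1) (x2, y2, z2)"
  shows "\<mu> = (\<nu>::'a::field)"
proof (rule ccontr)
  assume ne: "\<mu> \<noteq> \<nu>"
  define a where "a = y1 * x2 - y2 * x1"
  have "\<mu> * (\<mu> * a - (y * (x2 - x1) + x * (y1 - y2))) = 0" "\<nu> * (\<nu> * a - (y * (x2 - x1) + x * (y1 - y2))) = 0"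
    using assms(6,7) unfolding same_crossing2_def a_def by (simp_all, Groebner_Basis.algebra+)
  then have eq: "\<mu> * a = y * (x2 - x1) + x * (y1 - y2)" "\<nu> * a = y * (x2 - x1) + x * (y1 - y2)"
    using assms(4,5) by auto
  then have "(\<mu> - \<nu>) * a = 0" by Groebner_Basis.algebra
  then have a: "a = 0" using ne by simp
  have "(x1 - x2) * (y * x1 - x * y1) = 0"
    using a eq unfolding a_def by Groebner_Basis.algebra
  then have "x1 = x2" using assms(2) by simp
  moreover from this have "y1 = y2" using a eq assms(1) by simp
  ultimately show False using assms(3) by simp
qed

lemma card_le_1_if_unique:
  assumes "\<And>x y. x \<in> S \<Longrightarrow> y \<in> S \<Longrightarrow> x = y"
  shows "card S \<le> 1"
  using assms by (metis One_nat_def card_le_Suc0_iff_eq card.infinite zero_le)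

text \<open>Averaging over \<open>\<mu>\<close>. An incidence is bad for one value through equal
  slopes, and for at most one value per competing incidence at either end, so for at most 2 n^2 + 1
  values, where n is the size of A. This is at most a quarter of the nonzero scalars.\<close>

lemma exists_scaling_with_few_coincidences:
  fixes A B :: "'a::{field,finite} set"
  assumes A0: "0 \<notin> A" and small: "12 * (card A)\<^sup>2 < CARD('a)"
  defines "Q \<equiv> A \<times> A \<times> B"
  defines "E \<equiv> {(q, r) \<in> Q \<times> Q. incident q r \<and> fst (snd r) * fst q \<noteq> fst r * fst (snd q)}"
  defines "bad \<equiv> \<lambda>\<mu> (q, r). \<mu> * fst q = fst r \<or> (\<exists>r'\<in>Q - {r}. incident q r' \<and> same_crossing1 \<mu> q r r') \<or>
      (\<exists>q'\<in>Q - {q}. incident q' r \<and> same_crossing2 \<mu> r q q')"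
  obtains \<mu> where "\<mu> \<noteq> 0" "4 * card {e \<in> E. bad \<mu> e} \<le> card E"
proof -
  let ?n = "card A"
  have per_edge: "card {\<mu>. \<mu> \<noteq> 0 \<and> bad \<mu> e} \<le> 2 * ?n\<^sup>2 + 1" if e: "e \<in> E" for e
  proof -
    obtain x y z x' y' z' where E: "e = ((x, y, z), (x', y', z'))" by (metis prod.exhaust)
    let ?q = "(x, y, z)" and ?r = "(x', y', z')"
    have mem: "x \<in> A" "x' \<in> A" and inc: "incident ?q ?r" and nd: "y' * x \<noteq> x' * y"
      using e unfolding E assms(4) Q_def by auto
    have x0: "x \<noteq> 0" and x0': "x' \<noteq> 0" using mem A0 by auto
    define N1 where "N1 = {r' \<in> Q. incident ?q r'} - {?r}"
    define N2 where "N2 = {q' \<in> Q. incident q' ?r} - {?q}"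
    have "card N1 \<le> ?n\<^sup>2" "card N2 \<le> ?n\<^sup>2"
      using card_incident_le(1)[of A B ?q] card_incident_le(2)[of A B ?r] card_Diff1_le
      unfolding N1_def N2_def Q_def by (meson order_trans)+
    have "{\<mu>. \<mu> \<noteq> 0 \<and> bad \<mu> e} \<subseteq> {x' / x} \<union> (\<Union>r'\<in>N1. {\<mu>. same_crossing1 \<mu> ?q ?r r'})
        \<union> (\<Union>q'\<in>N2. {\<mu>. \<mu> \<noteq> 0 \<and> same_crossing2 \<mu> ?r ?q q'})"
      using x0 unfolding E assms(5) N1_def N2_def by (auto simp: field_simps)
    then have "card {\<mu>. \<mu> \<noteq> 0 \<and> bad \<mu> e} \<le> card ({x' / x} \<union> (\<Union>r'\<in>N1. {\<mu>. same_crossing1 \<mu> ?q ?r r'})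
        \<union> (\<Union>q'\<in>N2. {\<mu>. \<mu> \<noteq> 0 \<and> same_crossing2 \<mu> ?r ?q q'}))"
      by (intro card_mono) auto
    also have "\<dots> \<le> card {x' / x} + card (\<Union>r'\<in>N1. {\<mu>. same_crossing1 \<mu> ?q ?r r'})
        + card (\<Union>q'\<in>N2. {\<mu>. \<mu> \<noteq> 0 \<and> same_crossing2 \<mu> ?r ?q q'})"
      by (meson add_mono_thms_linordered_semiring(3) card_Un_le order_trans)
    also have "card (\<Union>r'\<in>N1. {\<mu>. same_crossing1 \<mu> ?q ?r r'}) \<le> ?n\<^sup>2"
    proof -
      have "card {\<mu>. same_crossing1 \<mu> ?q ?r r'} \<le> 1" if r': "r' \<in> N1" for r'
      proof -
        obtain a b d where R: "r' = (a, b, d)" by (metis prod.exhaust)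
        have "(x', y') \<noteq> (a, b)"
          using r' inc unfolding N1_def R incident_def by auto
        then show ?thesis
          using same_crossing1_unique[OF x0 nd] unfolding R by (intro card_le_1_if_unique) blast
      qed
      then have "(\<Sum>r'\<in>N1. card {\<mu>. same_crossing1 \<mu> ?q ?r r'}) \<le> card N1 * 1"
        by (intro sum_bounded_above[THEN order_trans]) auto
      moreover have "card (\<Union>r'\<in>N1. {\<mu>. same_crossing1 \<mu> ?q ?r r'}) \<le>
          (\<Sum>r'\<in>N1. card {\<mu>. same_crossing1 \<mu> ?q ?r r'})"
        by (rule card_UN_le) simp
      ultimately show ?thesis using \<open>card N1 \<le> ?n\<^sup>2\<close> by linarith
    qed
    also have "card (\<Union>q'\<in>N2. {\<mu>. \<mu> \<noteq> 0 \<and> same_crossing2 \<mu> ?r ?q q'}) \<le> ?n\<^sup>2"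
    proof -
      have "card {\<mu>. \<mu> \<noteq> 0 \<and> same_crossing2 \<mu> ?r ?q q'} \<le> 1" if q': "q' \<in> N2" for q'
      proof -
        obtain a b d where R: "q' = (a, b, d)" by (metis prod.exhaust)
        have "(x, y) \<noteq> (a, b)"
          using q' inc unfolding N2_def R incident_def by auto (metis add_left_cancel)
        then show ?thesis
          using same_crossing2_unique[OF x0' nd] unfolding R by (intro card_le_1_if_unique) blast
      qed
      then have "(\<Sum>q'\<in>N2. card {\<mu>. \<mu> \<noteq> 0 \<and> same_crossing2 \<mu> ?r ?q q'}) \<le> card N2 * 1"
        by (intro sum_bounded_above[THEN order_trans]) auto
      moreover have "card (\<Union>q'\<in>N2. {\<mu>. \<mu> \<noteq> 0 \<and> same_crossing2 \<mu> ?r ?q q'}) \<le>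
          (\<Sum>q'\<in>N2. card {\<mu>. \<mu> \<noteq> 0 \<and> same_crossing2 \<mu> ?r ?q q'})"
        by (rule card_UN_le) simp
      ultimately show ?thesis using \<open>card N2 \<le> ?n\<^sup>2\<close> by linarith
    qed
    finally show ?thesis by simp
  qed
  have "\<exists>\<mu>. \<mu> \<noteq> 0 \<and> 4 * card {e \<in> E. bad \<mu> e} \<le> card E"
  proof (rule ccontr)
    assume none: "\<nexists>\<mu>. \<mu> \<noteq> 0 \<and> 4 * card {e \<in> E. bad \<mu> e} \<le> card E"
    \<comment> \<open>Double counting of bad pairs. The summand 1 records the strict inequality and
      also gives a contradiction when E is empty.\<close>
    have "(CARD('a) - 1) * (card E + 1) = (\<Sum>\<mu>\<in>UNIV - {0::'a}. card E + 1)"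
      by (simp add: card_Diff_subset)
    also have "\<dots> \<le> (\<Sum>\<mu>\<in>UNIV - {0::'a}. 4 * card {e \<in> E. bad \<mu> e})"
      using none by (intro sum_mono) (auto simp: not_le Suc_le_eq)
    also have "\<dots> = 4 * (\<Sum>\<mu>\<in>UNIV - {0::'a}. \<Sum>e\<in>E. if bad \<mu> e then 1 else 0)"
      by (simp add: sum_distrib_left[symmetric] sum.If_cases Int_def)
    also have "\<dots> = 4 * (\<Sum>e\<in>E. \<Sum>\<mu>\<in>UNIV - {0::'a}. if bad \<mu> e then 1 else 0)"
      by (subst sum.swap) simp
    also have "\<dots> = 4 * (\<Sum>e\<in>E. card {\<mu>. \<mu> \<noteq> 0 \<and> bad \<mu> e})"
      by (simp add: sum.If_cases Int_def)
    also have "\<dots> \<le> 4 * (card E * (2 * ?n\<^sup>2 + 1))"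
    proof -
      have "(\<Sum>e\<in>E. card {\<mu>. \<mu> \<noteq> 0 \<and> bad \<mu> e}) \<le> of_nat (card E) * (2 * ?n\<^sup>2 + 1)"
        by (rule sum_bounded_above) (rule per_edge)
      then show ?thesis by simp
    qed
    finally have le: "(CARD('a) - 1) * (card E + 1) \<le> 4 * (2 * ?n\<^sup>2 + 1) * card E"
      by (simp only: mult_ac)
    have two_le: "2 \<le> CARD('a)" using card_mono[of UNIV "{0, 1::'a}"] by simp
    show False
    proof (cases "card E = 0")
      case True
      then show False using le two_le by simp
    next
      case False
      then have "E \<noteq> {}" by auto
      then have "A \<noteq> {}" by (auto simp: assms(4) Q_def)
      then have "?n > 0" by (simp add: card_gt_0_iff)
      then have "?n\<^sup>2 \<ge> 1" by (simp add: Suc_le_eq)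
      then have "4 * (2 * ?n\<^sup>2 + 1) \<le> 12 * ?n\<^sup>2" by simp
      also note small
      finally have "4 * (2 * ?n\<^sup>2 + 1) < CARD('a)" .
      then have "4 * (2 * ?n\<^sup>2 + 1) \<le> CARD('a) - 1" by simp
      then have "4 * (2 * ?n\<^sup>2 + 1) * card E \<le> (CARD('a) - 1) * card E"
        by (rule mult_right_mono) simp
      moreover have "(CARD('a) - 1) * (card E + 1) = (CARD('a) - 1) * card E + (CARD('a) - 1)"
        by (simp only: distrib_left mult_1_right)
      ultimately show False using le two_le by linarith
    qed
  qed
  then show thesis using that by blast
qed

text \<open>Too few values in T mean many incidences by Cauchy-Schwarz. After scaling and passing to
  a subgraph of large minimum degree, the corresponding null lines contradict
  \<open>null_lines_incidence\<close>.\<close>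

lemma square_sum_growth:
  fixes A B :: "'a::{field,finite} set"
  assumes char: "\<And>i. 0 < i \<Longrightarrow> i < CARD('a) \<Longrightarrow> of_nat i \<noteq> (0::'a)"
    and A0: "0 \<notin> A" and small: "1600 * (card A)\<^sup>2 \<le> CARD('a)"
  defines "T \<equiv> {(x - y)\<^sup>2 + z | x y z. x \<in> A \<and> y \<in> A \<and> z \<in> B}"
  shows "(card A)\<^sup>2 * card B \<le> (512 * card T)\<^sup>2"
proof (rule ccontr)
  assume contra: "\<not> ?thesis"
  define Q where "Q = A \<times> A \<times> B"
  define n where "n = card A"
  define N where "N = card Q"
  \<comment> \<open>R is the square root of the number of triples, rounded up.\<close>
  define R where "R = (LEAST r. N \<le> r\<^sup>2)"
  have N: "N = n\<^sup>2 * card B"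
    by (simp add: N_def Q_def n_def card_cartesian_product power2_eq_square)
  have TN: "(512 * card T)\<^sup>2 < N" using contra by (simp only: N n_def not_le)
  then have N_pos: "N > 0" by linarith
  then have n_pos: "n > 0" by (simp add: N)
  have R: "N \<le> R\<^sup>2"
    unfolding R_def by (rule LeastI[of _ N]) (simp add: power2_eq_square)
  have R_pos: "R > 0" using R N_pos by (cases R) auto
  have R4: "R\<^sup>2 \<le> 4 * N"
  proof (cases "R = 1")
    case False
    have "\<not> N \<le> (R - 1)\<^sup>2"
      unfolding R_def by (rule not_less_Least) (use R_pos in \<open>simp add: R_def\<close>)
    moreover have "R\<^sup>2 \<le> (2 * (R - 1))\<^sup>2" using False R_pos by (intro power_mono) auto
    ultimately show ?thesis by (simp add: power_mult_distrib)
  qed (use N_pos in simp)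
  have n_le_R: "n \<le> R"
  proof -
    have "card B > 0" using N_pos by (simp add: N)
    then have "n\<^sup>2 \<le> N" by (simp add: N)
    then have "n\<^sup>2 \<le> R\<^sup>2" using R by linarith
    then show ?thesis by (rule power2_le_imp_le) simp
  qed
  have TR: "512 * card T \<le> R"
  proof -
    have "(512 * card T)\<^sup>2 \<le> R\<^sup>2" using TN R by linarith
    then show ?thesis by (rule power2_le_imp_le) simp
  qed
  \<comment> \<open>This follows from 1600 * N <= p^2 and R^2 <= 4 * N, where p is the field size.
    It places 6 * m + 2 = 18 * R + 2 below the field size for m = 3 * R.\<close>
  have R_p: "20 * R \<le> CARD('a)"
  proof -
    have "card B \<le> CARD('a)" by (rule card_mono) auto
    then have "N * 1600 \<le> CARD('a) * CARD('a)"
      using small mult_mono[of "1600 * n\<^sup>2" "CARD('a)" "card B" "CARD('a)"] by (simp add: N n_def mult_ac)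
    then have "(20 * R)\<^sup>2 \<le> (CARD('a))\<^sup>2"
      using R4 by (simp add: power_mult_distrib power2_eq_square)
    then show ?thesis by (rule power2_le_imp_le) simp
  qed
  have p_big: "1600 \<le> CARD('a)"
  proof -
    have "1 \<le> n\<^sup>2" using n_pos by (simp add: Suc_le_eq)
    then show ?thesis using small unfolding n_def by linarith
  qed
  have two: "(2::'a) \<noteq> 0" using char[of 2] p_big by simp

  define I where "I = {(q, r) \<in> Q \<times> Q. incident q r}"
  define E where "E = {(q, r) \<in> Q \<times> Q. incident q r \<and> fst (snd r) * fst q \<noteq> fst r * fst (snd q)}"
  define bad where "bad = (\<lambda>\<mu> (q, r). \<mu> * fst q = fst r \<or> (\<exists>r'\<in>Q - {r}. incident q r' \<and> same_crossing1 \<mu> q r r') \<or>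
      (\<exists>q'\<in>Q - {q}. incident q' r \<and> same_crossing2 \<mu> r q q'))"
  have finQ: "finite Q" by (simp add: Q_def)
  obtain \<mu> where \<mu>: "\<mu> \<noteq> 0" "4 * card {e \<in> E. bad \<mu> e} \<le> card E"
  proof -
    have "12 * n\<^sup>2 < 1600 * n\<^sup>2" using n_pos by simp
    then have "12 * (card A)\<^sup>2 < CARD('a)" using small unfolding n_def by linarith
    from exists_scaling_with_few_coincidences[OF A0 this, of B] show ?thesis
      using that unfolding E_def bad_def Q_def by blast
  qed
  define G where "G = {e \<in> E. \<not> bad \<mu> e}"
  \<comment> \<open>Cauchy-Schwarz gives 128 * N * R incidences. At most N * R are degenerate, and
    three quarters of the rest survive: 127 * 3 / 4 > 95.\<close>
  have card_G: "95 * (N * R) \<le> card G"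
  proof -
    have "card E = card {e \<in> E. bad \<mu> e} + card G"
    proof -
      have "E = {e \<in> E. bad \<mu> e} \<union> G" by (auto simp: G_def)
      moreover have "card ({e \<in> E. bad \<mu> e} \<union> G) = card {e \<in> E. bad \<mu> e} + card G"
        by (intro card_Un_disjoint) (auto simp: G_def)
      ultimately show ?thesis by (rule ssubst)
    qed
    then have 1: "3 * card E \<le> 4 * card G" using \<mu>(2) by linarith
    have "I \<subseteq> E \<union> {(q, r) \<in> Q \<times> Q. incident q r \<and> fst (snd r) * fst q = fst r * fst (snd q)}"
      by (auto simp: I_def E_def)
    then have "card I \<le> card (E \<union> {(q, r) \<in> Q \<times> Q. incident q r \<and> fst (snd r) * fst q = fst r * fst (snd q)})"
      by (intro card_mono) auto
    also have "\<dots> \<le> card E + card {(q, r) \<in> Q \<times> Q. incident q r \<and> fst (snd r) * fst q = fst r * fst (snd q)}"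
      by (rule card_Un_le)
    also have "\<dots> \<le> card E + n * N"
      using card_degenerate_incidences_le[OF A0, of B] unfolding n_def N_def Q_def by simp
    also have "\<dots> \<le> card E + N * R" using n_le_R by simp
    finally have 2: "card I \<le> card E + N * R" .
    have "R * (128 * (N * R)) = 128 * N * R\<^sup>2" by (simp add: power2_eq_square)
    also have "\<dots> \<le> 128 * N * (4 * N)" using R4 by (rule mult_left_mono) simp
    also have "\<dots> = 512 * N\<^sup>2" by (simp add: power2_eq_square)
    also have "\<dots> \<le> 512 * (card T * card I)"
      using card_incidences_ge[of A B] unfolding I_def N_def Q_def T_def by simp
    also have "\<dots> \<le> R * card I" using mult_right_mono[OF TR, of "card I"] by simp
    finally have "128 * (N * R) \<le> card I" using R_pos by simp
    then show ?thesis using 1 2 by linarith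
  qed

  \<comment> \<open>The graph is bipartite on two copies of Q; \<open>False\<close> marks lines of
    the first kind and \<open>True\<close> those of the second.\<close>
  define L0 where "L0 = (UNIV :: bool set) \<times> Q"
  define nb where "nb = (\<lambda>(t, q). {(t', r). t' = (\<not> t) \<and> (if t then (r, q) \<in> G else (q, r) \<in> G)})"
  have nb_sym: "i \<in> nb j" if "j \<in> nb i" for i j
    using that by (auto simp: nb_def split: if_splits)
  have GQ: "q \<in> Q" "r \<in> Q" if "(q, r) \<in> G" for q r
    using that by (auto simp: G_def E_def)
  have degree_sum: "(\<Sum>i\<in>L0. card (nb i \<inter> L0)) = 2 * card G"
  proof -
    have F: "card (nb (False, q) \<inter> L0) = card {r \<in> Q. (q, r) \<in> G}" for q
    proof -
      have "nb (False, q) \<inter> L0 = Pair True ` {r \<in> Q. (q, r) \<in> G}" by (auto simp: nb_def L0_def)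
      then show ?thesis by (simp add: card_image inj_on_def)
    qed
    have T: "card (nb (True, r) \<inter> L0) = card {q \<in> Q. (q, r) \<in> G}" for r
    proof -
      have "nb (True, r) \<inter> L0 = Pair False ` {q \<in> Q. (q, r) \<in> G}" by (auto simp: nb_def L0_def)
      then show ?thesis by (simp add: card_image inj_on_def)
    qed
    have "card G = card (SIGMA q:Q. {r \<in> Q. (q, r) \<in> G})"
      by (rule arg_cong[of _ _ card]) (auto dest: GQ)
    then have 1: "(\<Sum>q\<in>Q. card {r \<in> Q. (q, r) \<in> G}) = card G"
      using finQ by (simp add: card_SigmaI)
    have "card G = card (G\<inverse>)" by (simp add: card_inverse)
    also have "G\<inverse> = (SIGMA r:Q. {q \<in> Q. (q, r) \<in> G})"
      by (auto dest: GQ)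
    finally have 2: "(\<Sum>r\<in>Q. card {q \<in> Q. (q, r) \<in> G}) = card G"
      using finQ by (simp add: card_SigmaI)
    have "(\<Sum>i\<in>L0. card (nb i \<inter> L0)) = (\<Sum>t\<in>UNIV. \<Sum>q\<in>Q. card (nb (t, q) \<inter> L0))"
      unfolding L0_def by (subst sum.cartesian_product) (simp add: split_def)
    also have "\<dots> = 2 * card G"
      by (simp add: UNIV_bool F T 1 2)
    finally show ?thesis .
  qed
  \<comment> \<open>There are 2 * N vertices and the degree sum is at least 190 * N * R, above the
    184 * N * R required for 46 * R. This in turn covers 15 * m + n with m = 3 * R, because n <=
    R.\<close>
  obtain L where L: "L \<subseteq> L0" "L \<noteq> {}" "\<And>i. i \<in> L \<Longrightarrow> 46 * R < card (nb i \<inter> L)"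
  proof (rule min_degree_subset[where nb = nb and K = "46 * R" and ?L0.0 = L0])
    show "finite L0" by (simp add: L0_def finQ)
    show "i \<in> nb j" if "j \<in> nb i" for i j using that by (rule nb_sym)
    show "i \<notin> nb i" for i by (auto simp: nb_def split_def)
    have "2 * (46 * R) * card L0 = 184 * (N * R)" by (simp add: L0_def N_def card_cartesian_product)
    moreover have "N * R > 0" using N_pos R_pos by simp
    ultimately show "2 * (46 * R) * card L0 < (\<Sum>i\<in>L0. card (nb i \<inter> L0))"
      unfolding degree_sum using card_G by linarith
    fix L assume "L \<subseteq> L0" "L \<noteq> {}" "\<And>i. i \<in> L \<Longrightarrow> 46 * R < card (nb i \<inter> L)"
    then show thesis by (rule that)
  qed

  define s where "s = (\<lambda>(t, (x::'a, y::'a, z::'a)). if t then 2 * x else 2 * \<mu> * x)"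
  define b where "b = (\<lambda>(t, (x::'a, y::'a, z::'a)). if t then y / \<mu> else y)"
  \<comment> \<open>The scaling cancels in the mixed term (y' / \<mu>) * (2 * \<mu> * x), so with
    this choice incidence gives the crossing condition for every nonzero \<mu>.\<close>
  define d where "d = (\<lambda>(t, (x, y, z)). b (t, (x, y, z)) * s (t, (x, y, z)) - (x\<^sup>2 + z - y\<^sup>2))"
  have G_D: "incident q r" "\<mu> * fst q \<noteq> fst r"
    "\<And>r'. r' \<in> Q \<Longrightarrow> incident q r' \<Longrightarrow> same_crossing1 \<mu> q r r' \<Longrightarrow> r' = r"
    "\<And>q'. q' \<in> Q \<Longrightarrow> incident q' r \<Longrightarrow> same_crossing2 \<mu> r q q' \<Longrightarrow> q' = q"
    if "(q, r) \<in> G" for q r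
    using that by (auto simp: G_def E_def bad_def)
  have adj: "(\<exists>q r. i = (False, q) \<and> j = (True, r) \<and> (q, r) \<in> G) \<or>
      (\<exists>q r. i = (True, r) \<and> j = (False, q) \<and> (q, r) \<in> G)" if "j \<in> nb i" for i j
    using that by (cases i; cases j; auto simp: nb_def split: if_splits)
  have meet_G: "s (False, q) \<noteq> s (True, r)"
    "(b (True, r) - b (False, q)) * (s (True, r) + s (False, q)) = d (True, r) - d (False, q)"
    if "(q, r) \<in> G" for q r
  proof -
    obtain x y z x' y' z' where qr: "q = (x, y, z)" "r = (x', y', z')" by (metis prod.exhaust)
    show "s (False, q) \<noteq> s (True, r)"
      using G_D(2)[OF that] two by (simp add: s_def qr)
    have inc: "(x - y')\<^sup>2 + z = (x' - y)\<^sup>2 + z'"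
      using G_D(1)[OF that] by (simp add: incident_def qr)
    define h where "h = y' / \<mu>"
    have h: "h * \<mu> = y'" using \<mu>(1) by (simp add: h_def)
    have "(h - y) * (2 * x' + 2 * \<mu> * x) = (h * (2 * x') - (x'\<^sup>2 + z' - y'\<^sup>2)) - (y * (2 * \<mu> * x) - (x\<^sup>2 + z - y\<^sup>2))"
      using inc h by Groebner_Basis.algebra
    then show "(b (True, r) - b (False, q)) * (s (True, r) + s (False, q)) = d (True, r) - d (False, q)"
      by (simp add: s_def b_def d_def qr h_def)
  qed
  have meet: "s i \<noteq> s j \<and> (b j - b i) * (s j + s i) = d j - d i" if "j \<in> nb i" for i j
    using adj[OF that]
  proof (elim disjE exE conjE)
    fix q r assume "i = (False, q)" "j = (True, r)" "(q, r) \<in> G"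
    then show ?thesis using meet_G by simp
  next
    fix q r assume ij: "i = (True, r)" "j = (False, q)" "(q, r) \<in> G"
    have "(b j - b i) * (s j + s i) = d j - d i"
      using meet_G(2)[OF ij(3)] unfolding ij(1,2) by Groebner_Basis.algebra
    then show ?thesis using meet_G(1)[OF ij(3)] ij by simp
  qed
  \<comment> \<open>Slope and offset recover the first two coordinates, and incidence with the
    common neighbour i recovers the third.\<close>
  have nb_eq: "j = j'" if nbs: "j \<in> nb i" "j' \<in> nb i" "s j = s j'" "b j = b j'" for i j j'
  proof -
    obtain t x y z where i: "i = (t, (x, y, z))" by (metis prod.exhaust)
    obtain x1 y1 z1 where jj: "j = (\<not> t, (x1, y1, z1))"
      using nbs(1) unfolding i nb_def by (cases j) auto
    obtain x2 y2 z2 where jj': "j' = (\<not> t, (x2, y2, z2))"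
      using nbs(2) unfolding i nb_def by (cases j') auto
    have xy: "x1 = x2" "y1 = y2"
      using nbs(3,4) two \<mu>(1) unfolding jj jj' s_def b_def by (auto split: if_splits)
    have "(if t then incident (x1, y1, z1) (x, y, z) else incident (x, y, z) (x1, y1, z1))"
      "(if t then incident (x2, y2, z2) (x, y, z) else incident (x, y, z) (x2, y2, z2))"
      using nbs(1,2) G_D(1) unfolding i jj jj' nb_def by auto
    then have "z1 = z2"
      unfolding xy incident_def by (auto split: if_splits) (metis add_left_cancel)
    then show ?thesis using xy by (simp add: jj jj')
  qed
  show False
  proof (rule null_lines_incidence[where L = L and nb = "\<lambda>i. nb i \<inter> L" and s = s and b = b and d = d
        and m = "3 * R" and n = n])
    show "finite L" using L(1) finQ by (auto simp: L0_def intro: finite_subset)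
    show "L \<noteq> {}" by (rule L(2))
    show "nb i \<inter> L \<subseteq> L" for i by blast
    show "i \<in> nb j \<inter> L" if "i \<in> L" "j \<in> nb i \<inter> L" for i j
      using that nb_sym by blast
    show "s i \<noteq> s j \<and> (b j - b i) * (s j + s i) = d j - d i" if "i \<in> L" "j \<in> nb i \<inter> L" for i j
      using that meet by blast
    show "3 * card L \<le> (3 * R + 1)\<^sup>2"
    proof -
      have "card L \<le> card L0" using L(1) finQ by (intro card_mono) (auto simp: L0_def)
      also have "\<dots> = 2 * N" by (simp add: L0_def N_def card_cartesian_product)
      finally have "3 * card L \<le> 6 * R\<^sup>2" using R by linarith
      also have "\<dots> \<le> (3 * R + 1)\<^sup>2" by (simp add: power2_eq_square algebra_simps)
      finally show ?thesis .
    qed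
    show "of_nat i \<noteq> (0::'a)" if "0 < i" "i \<le> 6 * (3 * R) + 2" for i
      using char[OF that(1)] that(2) R_p R_pos p_big by linarith
    show "15 * (3 * R) + n < card (nb i \<inter> L)" if "i \<in> L" for i
      using L(3)[OF that] n_le_R by linarith
    show "inj_on (\<lambda>j. (b j - b i) / (s i - s j)) (nb i \<inter> L)" if "i \<in> L" for i
    proof (rule inj_onI)
      fix j j' assume j: "j \<in> nb i \<inter> L" and j': "j' \<in> nb i \<inter> L"
        and eq: "(b j - b i) / (s i - s j) = (b j' - b i) / (s i - s j')"
      have "s i - s j \<noteq> 0" "s i - s j' \<noteq> 0" using meet j j' by auto
      then have eq': "(b j - b i) * (s i - s j') = (b j' - b i) * (s i - s j)"
        using eq by (simp add: frac_eq_eq)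
      obtain t x y z where i: "i = (t, (x, y, z))" by (metis prod.exhaust)
      obtain x1 y1 z1 where jj: "j = (\<not> t, (x1, y1, z1))"
        using j unfolding i nb_def by (cases j) auto
      obtain x2 y2 z2 where jj': "j' = (\<not> t, (x2, y2, z2))"
        using j' unfolding i nb_def by (cases j') auto
      show "j = j'"
      proof (cases t)
        case False
        then have e: "((x, y, z), (x1, y1, z1)) \<in> G" "((x, y, z), (x2, y2, z2)) \<in> G"
          using j j' unfolding i jj jj' nb_def by auto
        have "(y1 / \<mu> - y) * (2 * \<mu> * x - 2 * x2) = (y2 / \<mu> - y) * (2 * \<mu> * x - 2 * x1)"
          using eq' False unfolding i jj jj' by (simp add: s_def b_def)
        moreover have "y1 / \<mu> * \<mu> = y1" "y2 / \<mu> * \<mu> = y2" using \<mu>(1) by simp_all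
        ultimately have "2 * ((y1 - \<mu> * y) * (\<mu> * x - x2) - (y2 - \<mu> * y) * (\<mu> * x - x1)) = 0"
          by Groebner_Basis.algebra
        then have "same_crossing1 \<mu> (x, y, z) (x1, y1, z1) (x2, y2, z2)"
          using two by (simp add: same_crossing1_def)
        then have "(x2, y2, z2) = (x1, y1, z1)"
          using G_D(3)[OF e(1)] G_D(1)[OF e(2)] GQ(2)[OF e(2)] by blast
        then show ?thesis by (simp add: jj jj')
      next
        case True
        then have e: "((x1, y1, z1), (x, y, z)) \<in> G" "((x2, y2, z2), (x, y, z)) \<in> G"
          using j j' unfolding i jj jj' nb_def by auto
        have "(y1 - y / \<mu>) * (2 * x - 2 * \<mu> * x2) = (y2 - y / \<mu>) * (2 * x - 2 * \<mu> * x1)"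
          using eq' True unfolding i jj jj' by (simp add: s_def b_def)
        moreover have "y / \<mu> * \<mu> = y" using \<mu>(1) by simp
        ultimately have "2 * ((y - \<mu> * y1) * (\<mu> * x2 - x) - (y - \<mu> * y2) * (\<mu> * x1 - x)) = 0"
          by Groebner_Basis.algebra
        then have "same_crossing2 \<mu> (x, y, z) (x1, y1, z1) (x2, y2, z2)"
          using two by (simp add: same_crossing2_def)
        then have "(x2, y2, z2) = (x1, y1, z1)"
          using G_D(4)[OF e(1)] G_D(1)[OF e(2)] GQ(1)[OF e(2)] by blast
        then show ?thesis by (simp add: jj jj')
      qed
    qed
    show "card {j \<in> nb i \<inter> L. c * (s j - s i) - k * (b j - b i) = 1} \<le> n" if "i \<in> L" for i c k
    proof -
      let ?S = "{j \<in> nb i \<inter> L. c * (s j - s i) - k * (b j - b i) = 1}"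
      \<comment> \<open>For k = 0 the equation fixes the slope, so the offset identifies the line;
        otherwise the slope determines the offset. On one side of the graph either quantity takes at
        most n values.\<close>
      define g where "g = (if k = 0 then b else s)"
      have "inj_on g ?S"
      proof (rule inj_onI)
        fix j j' assume j: "j \<in> ?S" and j': "j' \<in> ?S" and eq: "g j = g j'"
        have rel: "c * (s j - s i) - k * (b j - b i) = 1" "c * (s j' - s i) - k * (b j' - b i) = 1"
          using j j' by auto
        have "s j = s j' \<and> b j = b j'"
        proof (cases "k = 0")
          case True
          then have "c \<noteq> 0" "c * (s j - s j') = 0" using rel by (auto simp: algebra_simps)
          then show ?thesis using eq True by (simp add: g_def)
        next
          case False
          then have "k * (b j - b j') = 0" using rel eq unfolding g_def by (simp add: algebra_simps)
          then show ?thesis using eq False by (simp add: g_def)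
        qed
        then show "j = j'" using nb_eq[of j i j'] j j' by blast
      qed
      then have "card ?S = card (g ` ?S)" by (simp add: card_image)
      also have "\<dots> \<le> n"
      proof -
        obtain h where "g ` ?S \<subseteq> h ` A"
        proof -
          obtain t q where i: "i = (t, q)" by (cases i)
          have S: "\<exists>x y z. j = (\<not> t, (x, y, z)) \<and> x \<in> A \<and> y \<in> A" if "j \<in> ?S" for j
            using that L(1) unfolding i nb_def L0_def Q_def by auto
          define h where "h = (\<lambda>a. if k = 0 then (if t then a else a / \<mu>) else (if t then 2 * \<mu> * a else 2 * a))"
          have "g ` ?S \<subseteq> h ` A"
          proof
            fix u assume "u \<in> g ` ?S"
            then obtain j where "j \<in> ?S" and u: "u = g j" by blast
            then obtain x y z where "j = (\<not> t, (x, y, z))" "x \<in> A" "y \<in> A" using S by blast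
            then show "u \<in> h ` A" by (auto simp: u g_def h_def s_def b_def)
          qed
          then show thesis by (rule that)
        qed
        then have "card (g ` ?S) \<le> card (h ` A)" by (intro card_mono) auto
        also have "\<dots> \<le> n" unfolding n_def by (rule card_image_le) simp
        finally show ?thesis .
      qed
      finally show ?thesis .
    qed
  qed
qed

section \<open>Quotients\<close>

text \<open>If \<open>t\<close> is not a quotient, then \<open>a - t * c = t * e - b\<close> has only the trivial solutions with
  \<open>a + b = c + e = 0\<close>, whereas on average over \<open>t\<close> the values \<open>a - t * c\<close> are almost equidistributed.\<close>

lemma card_quotients_of_sumset:
  fixes D :: "'a::{field,finite} set"
  assumes big: "4 * CARD('a) \<le> (card D)\<^sup>2" and p7: "7 \<le> CARD('a)"
  defines "S \<equiv> {a + b | a b. a \<in> D \<and> b \<in> D}"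
  shows "CARD('a) \<le> 3 * card {t. \<exists>a\<in>S. \<exists>b\<in>S. b \<noteq> 0 \<and> t * b = a}"
proof -
  define p where "p = real CARD('a)"
  define n where "n = real (card D)"
  define Q where "Q = {t. \<exists>a\<in>S. \<exists>b\<in>S. b \<noteq> 0 \<and> t * b = a}"
  define U where "U = {t. t \<noteq> 0 \<and> t \<notin> Q}"
  define r where "r t x = card {(a, c) \<in> D \<times> D. a - t * c = x}" for t x
  define E where "E t = (\<Sum>x\<in>UNIV. (real (r t x))\<^sup>2)" for t
  have p_pos: "p > 0" by (simp add: p_def)
  have n2: "n\<^sup>2 \<ge> 4 * p"
  proof -
    have "real (4 * CARD('a)) \<le> real ((card D)\<^sup>2)" using big by (simp only: of_nat_le_iff)
    then show ?thesis by (simp add: n_def p_def)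
  qed
  have sum_r: "(\<Sum>x\<in>UNIV. real (r t x)) = n\<^sup>2" for t
  proof -
    have "(\<Sum>x\<in>UNIV. r t x) = card (\<Union>x\<in>UNIV. {(a, c) \<in> D \<times> D. a - t * c = x})"
      unfolding r_def by (rule card_UN_disjoint[symmetric]) auto
    also have "(\<Union>x\<in>UNIV. {(a, c) \<in> D \<times> D. a - t * c = x}) = D \<times> D" by auto
    finally show ?thesis
      by (simp add: n_def card_cartesian_product power2_eq_square flip: of_nat_sum of_nat_mult)
  qed
  have E_ge: "n ^ 4 / p \<le> E t" for t
  proof -
    have "(n\<^sup>2)\<^sup>2 \<le> E t * p"
      using sum_squared_le_sum_of_squares[of "\<lambda>x. real (r t x)" UNIV] unfolding sum_r E_def p_def by simp
    then show ?thesis using p_pos by (simp add: divide_le_eq flip: power_mult)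
  qed
  have E_U: "2 * n ^ 4 / p - n\<^sup>2 \<le> E t" if t: "t \<in> U" for t
  proof -
    have t0: "t \<noteq> 0" and tQ: "t \<notin> Q" using t by (auto simp: U_def)
    define M where "M = {((a, c), (b, e)) \<in> (D \<times> D) \<times> (D \<times> D). b - t * e = - (a - t * c)}"
    have "(\<Sum>x\<in>UNIV. r t x * r t (- x)) = card M"
    proof -
      have M_eq: "M = (\<Union>x\<in>UNIV. {(a, c) \<in> D \<times> D. a - t * c = x} \<times> {(a, c) \<in> D \<times> D. a - t * c = - x})"
        unfolding M_def by auto
      have "card M = (\<Sum>x\<in>UNIV. card ({(a, c) \<in> D \<times> D. a - t * c = x} \<times> {(a, c) \<in> D \<times> D. a - t * c = - x}))"
        unfolding M_eq
      proof (rule card_UN_disjoint)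
        show "\<forall>x\<in>UNIV. \<forall>y\<in>UNIV. x \<noteq> y \<longrightarrow>
            ({(a, c) \<in> D \<times> D. a - t * c = x} \<times> {(a, c) \<in> D \<times> D. a - t * c = - x}) \<inter>
            ({(a, c) \<in> D \<times> D. a - t * c = y} \<times> {(a, c) \<in> D \<times> D. a - t * c = - y}) = {}"
          by fast
      qed simp_all
      then show ?thesis unfolding r_def card_cartesian_product by (rule sym)
    qed
    moreover have "card M \<le> card (D \<times> D)"
    proof (rule card_inj_on_le)
      \<comment> \<open>If c + e were nonzero, t would be the quotient of a + b by c + e. So only a
        + b = c + e = 0 remains, and the first pair determines the second.\<close>
      have deg: "c + e = 0 \<and> a + b = 0" if "((a, c), (b, e)) \<in> M" for a b c e
      proof -
        have mem: "a \<in> D" "b \<in> D" "c \<in> D" "e \<in> D" and "b - t * e = - (a - t * c)"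
          using that by (simp_all add: M_def)
        then have eq: "t * (c + e) = a + b" by Groebner_Basis.algebra
        have "a + b \<in> S" "c + e \<in> S" using mem unfolding S_def by blast+
        then have "c + e = 0" using tQ eq unfolding Q_def by blast
        then show ?thesis using eq by simp
      qed
      show "inj_on fst M"
      proof (rule inj_onI)
        fix u v assume u: "u \<in> M" and v: "v \<in> M" and eq: "fst u = fst v"
        obtain a c b e where U: "u = ((a, c), (b, e))" by (metis prod.exhaust)
        obtain b' e' where V: "v = ((a, c), (b', e'))" using eq U by (metis fst_conv prod.exhaust)
        have "c + e = 0 \<and> a + b = 0" "c + e' = 0 \<and> a + b' = 0"
          using u v unfolding U V by (auto dest: deg)
        then have "e = e'" "b = b'" by (metis add_left_cancel)+
        then show "u = v" unfolding U V by simp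
      qed
      show "fst ` M \<subseteq> D \<times> D" by (auto simp: M_def)
    qed simp
    ultimately have "real (\<Sum>x\<in>UNIV. r t x * r t (- x)) \<le> n\<^sup>2"
      by (simp add: n_def card_cartesian_product power2_eq_square flip: of_nat_mult)
    then have N: "(\<Sum>x\<in>UNIV. real (r t x) * real (r t (- x))) \<le> n\<^sup>2" by simp
    have flip: "(\<Sum>x\<in>UNIV. f (- x)) = (\<Sum>x\<in>UNIV. f x)" for f :: "'a \<Rightarrow> real"
      by (rule sum.reindex_bij_witness[of _ uminus uminus]) auto
    \<comment> \<open>Cauchy-Schwarz for the symmetrised counts, whose total is 2 * n^2. As their
      mixed term is at most n^2, \<open>E t\<close> is forced to nearly twice the general lower
      bound n^4 / p.\<close>
    have "(\<Sum>x\<in>UNIV. real (r t x) + real (r t (- x)))\<^sup>2 \<le> (\<Sum>x\<in>UNIV. (real (r t x) + real (r t (- x)))\<^sup>2) * p"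
      using sum_squared_le_sum_of_squares[of "\<lambda>x. real (r t x) + real (r t (- x))" UNIV] by (simp add: p_def)
    moreover have "(\<Sum>x\<in>UNIV. real (r t x) + real (r t (- x))) = 2 * n\<^sup>2"
      unfolding sum.distrib flip[of "\<lambda>x. real (r t x)"] sum_r by simp
    moreover have "(\<Sum>x\<in>UNIV. (real (r t x) + real (r t (- x)))\<^sup>2) =
        2 * E t + 2 * (\<Sum>x\<in>UNIV. real (r t x) * real (r t (- x)))"
      unfolding power2_sum sum.distrib flip[of "\<lambda>x. (real (r t x))\<^sup>2"] E_def
      by (simp add: sum_distrib_left mult.assoc)
    ultimately have "(2 * n\<^sup>2)\<^sup>2 \<le> (2 * E t + 2 * (\<Sum>x\<in>UNIV. real (r t x) * real (r t (- x)))) * p"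
      by simp
    also have "\<dots> \<le> (2 * E t + 2 * n\<^sup>2) * p"
      using N p_pos by (intro mult_right_mono) auto
    finally have "(2 * n\<^sup>2)\<^sup>2 \<le> (2 * E t + 2 * n\<^sup>2) * p" .
    then have "2 * n ^ 4 \<le> (E t + n\<^sup>2) * p"
      by (simp add: power_mult_distrib algebra_simps flip: power_mult)
    then show ?thesis using p_pos by (simp add: field_simps)
  qed
  \<comment> \<open>\<open>E t\<close> counts solutions of a - b = t * (c - e). The diagonal ones
    contribute n^2 for each t, and every other quadruple occurs for at most one t.\<close>
  have E_sum: "(\<Sum>t\<in>UNIV - {0}. E t) \<le> p * n\<^sup>2 + n ^ 4"
  proof -
    define P where "P t = {((a, c), (b, e)) \<in> (D \<times> D) \<times> (D \<times> D). a - t * c = b - t * e}" for t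
    have E_P: "E t = real (card (P t))" for t
    proof -
      have P_eq: "P t = (\<Union>x\<in>UNIV. {(a, c) \<in> D \<times> D. a - t * c = x} \<times> {(a, c) \<in> D \<times> D. a - t * c = x})"
        unfolding P_def by auto
      have "card (P t) = (\<Sum>x\<in>UNIV. card ({(a, c) \<in> D \<times> D. a - t * c = x} \<times> {(a, c) \<in> D \<times> D. a - t * c = x}))"
        unfolding P_eq by (rule card_UN_disjoint) auto
      then show ?thesis by (simp add: card_cartesian_product r_def E_def power2_eq_square)
    qed
    define P0 where "P0 = {((a, c), (b, e)) \<in> (D \<times> D) \<times> (D \<times> D). c = e \<and> a = b}"
    have P0: "card P0 = card (D \<times> D)"
    proof -
      have "P0 = (\<lambda>u. (u, u)) ` (D \<times> D)" by (auto simp: P0_def)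
      then show ?thesis by (simp add: card_image inj_on_def)
    qed
    have P_le: "card (P t) \<le> card P0 + card (P t - P0)" for t
    proof -
      have "card (P t) \<le> card (P0 \<union> (P t - P0))" by (intro card_mono) auto
      also have "\<dots> \<le> card P0 + card (P t - P0)" by (rule card_Un_le)
      finally show ?thesis .
    qed
    have "(\<Sum>t\<in>UNIV - {0}. card (P t - P0)) = card (\<Union>t\<in>UNIV - {0}. P t - P0)"
    proof (rule card_UN_disjoint[symmetric])
      show "\<forall>t\<in>UNIV - {0}. \<forall>t'\<in>UNIV - {0}. t \<noteq> t' \<longrightarrow> (P t - P0) \<inter> (P t' - P0) = {}"
      proof (intro ballI impI, rule ccontr)
        fix t t' assume "t \<noteq> t'" "(P t - P0) \<inter> (P t' - P0) \<noteq> {}"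
        then obtain a c b e where "((a, c), (b, e)) \<in> P t" "((a, c), (b, e)) \<in> P t'" "((a, c), (b, e)) \<notin> P0"
          by fast
        then have eq: "a - t * c = b - t * e" "a - t' * c = b - t' * e" and ne: "\<not> (c = e \<and> a = b)"
          by (auto simp: P_def P0_def)
        have "(t - t') * (c - e) = 0" using eq by Groebner_Basis.algebra
        then have "c = e" using \<open>t \<noteq> t'\<close> by simp
        then show False using eq ne by simp
      qed
    qed auto
    also have "\<dots> \<le> card ((D \<times> D) \<times> (D \<times> D))"
      by (intro card_mono) (auto simp: P_def)
    finally have "(\<Sum>t\<in>UNIV - {0}. card (P t - P0)) \<le> card D ^ 4"
      by (simp add: card_cartesian_product power4_eq_xxxx mult.assoc)
    then have "real (\<Sum>t\<in>UNIV - {0}. card (P t - P0)) \<le> real (card D ^ 4)"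
      by (simp only: of_nat_le_iff)
    then have rest: "(\<Sum>t\<in>UNIV - {0}. real (card (P t - P0))) \<le> n ^ 4"
      by (simp add: n_def)
    have "(\<Sum>t\<in>UNIV - {0}. E t) \<le> (\<Sum>t\<in>UNIV - {0::'a}. n\<^sup>2 + real (card (P t - P0)))"
      unfolding E_P
    proof (rule sum_mono)
      fix t :: 'a
      show "real (card (P t)) \<le> n\<^sup>2 + real (card (P t - P0))"
        using P_le[of t] unfolding P0 by (simp add: n_def card_cartesian_product power2_eq_square flip: of_nat_mult of_nat_add)
    qed
    also have "\<dots> = real (CARD('a) - 1) * n\<^sup>2 + (\<Sum>t\<in>UNIV - {0}. real (card (P t - P0)))"
      by (simp add: sum.distrib card_Diff_subset)
    also have "\<dots> \<le> p * n\<^sup>2 + n ^ 4"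
      using rest by (intro add_mono mult_right_mono) (auto simp: p_def)
    finally show ?thesis .
  qed
  define u where "u = real (card U)"
  define w where "w = n ^ 4 / p"
  \<comment> \<open>Every t in U exceeds the lower bound w by at least w - n^2, while
    \<open>E_sum\<close> leaves a total excess of at most p * n^2 + w.\<close>
  have "(p - 1 - u) * w + u * (2 * w - n\<^sup>2) \<le> (\<Sum>t\<in>UNIV - {0}. E t)"
  proof -
    have U: "U \<subseteq> UNIV - {0}" by (auto simp: U_def)
    have "(\<Sum>t\<in>UNIV - {0}. E t) = (\<Sum>t\<in>U. E t) + (\<Sum>t\<in>UNIV - {0} - U. E t)"
      using U by (subst sum.subset_diff[of U]) auto
    moreover have "u * (2 * w - n\<^sup>2) \<le> (\<Sum>t\<in>U. E t)"
      using sum_bounded_below[of U "2 * w - n\<^sup>2" E] E_U by (simp add: u_def w_def)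
    moreover have "(p - 1 - u) * w \<le> (\<Sum>t\<in>UNIV - {0} - U. E t)"
    proof -
      have "card (UNIV - {0} - U) = CARD('a) - 1 - card U"
        using U by (simp add: card_Diff_subset)
      moreover have "card U \<le> CARD('a) - 1"
        using card_mono[OF _ U] by (simp add: card_Diff_subset)
      ultimately have "real (card (UNIV - {0} - U)) = p - 1 - u"
        using p7 by (simp add: p_def u_def of_nat_diff)
      then show ?thesis
        using sum_bounded_below[of "UNIV - {0} - U" w E] E_ge by (simp add: w_def)
    qed
    ultimately show ?thesis by linarith
  qed
  with E_sum have main: "(p - 1 - u) * w + u * (2 * w - n\<^sup>2) \<le> p * n\<^sup>2 + n ^ 4" by linarith
  have w4: "4 * n\<^sup>2 \<le> w"
  proof -
    have "4 * p * n\<^sup>2 \<le> n\<^sup>2 * n\<^sup>2" using n2 by (intro mult_right_mono) auto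
    then show ?thesis using p_pos by (simp add: w_def le_divide_eq power4_eq_xxxx power2_eq_square mult_ac)
  qed
  have pw: "n ^ 4 = p * w" using p_pos by (simp add: w_def)
  have w_pos: "w > 0" using n2 p_pos w4 by linarith
  have u0: "u \<ge> 0" by (simp add: u_def)
  have "u * (w - n\<^sup>2) \<le> p * n\<^sup>2 + w" using main unfolding pw by (simp add: algebra_simps)
  moreover have "u * (w - w / 4) \<le> u * (w - n\<^sup>2)" using u0 w4 by (intro mult_left_mono) auto
  moreover have "p * n\<^sup>2 \<le> p * (w / 4)" using p_pos w4 by (intro mult_left_mono) auto
  ultimately have "(3 / 4 * u) * w \<le> (p / 4 + 1) * w" by (simp add: algebra_simps)
  then have u_le: "3 / 4 * u \<le> p / 4 + 1" using w_pos by simp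
  have "UNIV - {0} \<subseteq> U \<union> Q" by (auto simp: U_def)
  then have "card (UNIV - {0::'a}) \<le> card (U \<union> Q)" by (intro card_mono) auto
  also have "\<dots> \<le> card U + card Q" by (rule card_Un_le)
  finally have "p - 1 \<le> u + real (card Q)"
    by (simp add: p_def u_def card_Diff_subset)
  \<comment> \<open>The bounds leave at least 2 * p / 3 - 7 / 3 quotients, which reaches p / 3
    exactly from p = 7 on.\<close>
  then have "p \<le> 3 * real (card Q)"
    using u_le p7 unfolding p_def by linarith
  then show ?thesis unfolding p_def Q_def by linarith
qed

section \<open>Iterated sums of squared differences\<close>

primrec square_sums :: "'a::comm_ring_1 set \<Rightarrow> nat \<Rightarrow> 'a set" where
  "square_sums A 0 = {0}"
| "square_sums A (Suc k) = {(x - y)\<^sup>2 + z | x y z. x \<in> A \<and> y \<in> A \<and> z \<in> square_sums A k}"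

lemma square_sums_mono: "A \<subseteq> B \<Longrightarrow> square_sums A k \<subseteq> square_sums B k"
proof (induction k)
  case (Suc k)
  then show ?case unfolding square_sums.simps by blast
qed simp

lemma square_sums_add: "square_sums A (j + k) = {a + b | a b. a \<in> square_sums A j \<and> b \<in> square_sums A k}"
proof (induction j)
  case (Suc j)
  show ?case
  proof (intro equalityI subsetI)
    fix u assume "u \<in> square_sums A (Suc j + k)"
    then obtain x y a b where "u = (x - y)\<^sup>2 + (a + b)" "x \<in> A" "y \<in> A" "a \<in> square_sums A j" "b \<in> square_sums A k"
      unfolding add_Suc square_sums.simps Suc by blast
    then have "u = ((x - y)\<^sup>2 + a) + b" "(x - y)\<^sup>2 + a \<in> square_sums A (Suc j)" "b \<in> square_sums A k"
      by (auto simp: add.assoc)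
    then show "u \<in> {a + b | a b. a \<in> square_sums A (Suc j) \<and> b \<in> square_sums A k}" by blast
  next
    fix u assume "u \<in> {a + b | a b. a \<in> square_sums A (Suc j) \<and> b \<in> square_sums A k}"
    then obtain x y a b where "u = ((x - y)\<^sup>2 + a) + b" "x \<in> A" "y \<in> A" "a \<in> square_sums A j" "b \<in> square_sums A k"
      by auto
    then have "u = (x - y)\<^sup>2 + (a + b)" "x \<in> A" "y \<in> A" "a + b \<in> square_sums A (j + k)"
      unfolding Suc by (auto simp: add.assoc)
    then show "u \<in> square_sums A (Suc j + k)" by auto
  qed
qed simp

text \<open>Iteration of \<open>square_sum_growth\<close>. The inequality is the 2^k-th power of
  |R_k| >= |A|^(2 - 2^(1 - k)) / 512^2, where R_k is \<open>square_sums A k\<close>; this form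
  avoids roots.\<close>

lemma card_square_sums_ge:
  fixes A :: "'a::{field,finite} set"
  assumes char: "\<And>i. 0 < i \<Longrightarrow> i < CARD('a) \<Longrightarrow> of_nat i \<noteq> (0::'a)"
    and A0: "0 \<notin> A" and small: "1600 * (card A)\<^sup>2 \<le> CARD('a)"
  shows "card A ^ (2 ^ (k + 1) - 2) \<le> 512 ^ 2 ^ (k + 1) * card (square_sums A k) ^ 2 ^ k"
proof (induction k)
  case (Suc k)
  let ?n = "card A" and ?c = "card (square_sums A k)" and ?c' = "card (square_sums A (Suc k))"
  have "?n\<^sup>2 * ?c \<le> (512 * ?c')\<^sup>2"
    using square_sum_growth[OF char A0 small, of "square_sums A k"] by simp
  then have "(?n\<^sup>2 * ?c) ^ 2 ^ k \<le> ((512 * ?c')\<^sup>2) ^ 2 ^ k"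
    by (rule power_mono) simp
  then have step: "?n ^ 2 ^ (k + 1) * ?c ^ 2 ^ k \<le> 512 ^ 2 ^ (k + 1) * ?c' ^ 2 ^ (k + 1)"
    by (simp only: power_mult_distrib power_mult[symmetric] Suc_eq_plus1[symmetric] power_Suc)
  have exp: "2 ^ (Suc k + 1) - 2 = 2 ^ (k + 1) + (2 ^ (k + 1) - (2::nat))"
    by simp
  have "?n ^ (2 ^ (Suc k + 1) - 2) = ?n ^ 2 ^ (k + 1) * ?n ^ (2 ^ (k + 1) - 2)"
    unfolding exp by (rule power_add)
  also have "\<dots> \<le> ?n ^ 2 ^ (k + 1) * (512 ^ 2 ^ (k + 1) * ?c ^ 2 ^ k)"
    using Suc by (rule mult_left_mono) simp
  also have "\<dots> = 512 ^ 2 ^ (k + 1) * (?n ^ 2 ^ (k + 1) * ?c ^ 2 ^ k)"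
    by (simp only: mult_ac)
  also have "\<dots> \<le> 512 ^ 2 ^ (k + 1) * (512 ^ 2 ^ (k + 1) * ?c' ^ 2 ^ (k + 1))"
    using step by (rule mult_left_mono) simp
  also have "\<dots> = (512 ^ 2 ^ (k + 1) * 512 ^ 2 ^ (k + 1)) * ?c' ^ 2 ^ Suc k"
    by (simp only: mult_ac Suc_eq_plus1)
  also have "512 ^ 2 ^ (k + 1) * 512 ^ 2 ^ (k + 1) = (512 ^ 2 ^ (Suc k + 1) :: nat)"
    unfolding power_add[symmetric] by simp
  finally show ?case .
qed simp

section \<open>Constants and the quotient bound over a finite field\<close>

text \<open>\<open>size_const\<close> is what the growth argument needs of a subset; \<open>prime_const\<close> bounds the primes for which the
  smallest such subset violates \<open>1600 * n\<^sup>2 \<le> p\<close>, and \<open>hyp_const\<close> excludes these primes.\<close>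

definition size_const :: "nat \<Rightarrow> nat" where
  "size_const k = 512 ^ 2 ^ (k + 1) * 4 ^ 2 ^ (k - 1)"

definition prime_const :: "nat \<Rightarrow> nat" where
  "prime_const k = 1600 ^ (2 ^ (k + 1) - 2) * (2 ^ (2 ^ (k + 1) - 2) * size_const k)\<^sup>2"

definition hyp_const :: "nat \<Rightarrow> nat" where
  "hyp_const k = 2 ^ (2 ^ (k + 1) - 2) * size_const k * prime_const k ^ (2 ^ (k + 1) - 2)"

lemma consts_pos: "size_const k > 0" "prime_const k > 0" "hyp_const k > 0"
  by (simp_all add: size_const_def prime_const_def hyp_const_def)

text \<open>The growth estimate concerns sets without 0 whose size is small against the square root
  of p. So A is thinned to a subset of the least size for which growth still yields |D|^2 >= 4 * p;
  quotients of the subset are quotients for A.\<close>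

lemma card_quotients_of_square_sums:
  fixes A :: "'a::{field,finite} set"
  assumes char: "\<And>i. 0 < i \<Longrightarrow> i < CARD('a) \<Longrightarrow> of_nat i \<noteq> (0::'a)"
    and k: "k \<ge> 2"
    and hyp: "hyp_const k * CARD('a) ^ 2 ^ (k - 1) \<le> card A ^ (2 ^ (k + 1) - 2)"
  defines "S \<equiv> square_sums A (2 * k)"
  shows "CARD('a) \<le> 3 * card {t. \<exists>a\<in>S. \<exists>b\<in>S. b \<noteq> 0 \<and> t * b = a}"
proof -
  define p where "p = CARD('a)"
  define e :: nat where "e = 2 ^ (k + 1) - 2"
  define f :: nat where "f = 2 ^ (k - 1)"
  define H where "H = size_const k"
  have k1: "k = Suc (k - 1)" using k by simp
  have f2: "2 \<le> f"
    unfolding f_def using power_increasing[of 1 "k - 1" "2::nat"] k by simp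
  have f2k: "2 * f = 2 ^ k" unfolding f_def by (subst (2) k1) simp
  have e: "e = 4 * f - 2" unfolding e_def by (simp add: f2k[symmetric])
  have e_gt: "2 * f < e" using f2 e by linarith
  have p1: "p \<ge> 1" by (simp add: p_def Suc_le_eq)
  have H1: "H \<ge> 1" using consts_pos(1)[of k] by (simp add: H_def)
  have hyp': "hyp_const k * p ^ f \<le> card A ^ e"
    using hyp by (simp add: p_def e_def f_def)
  have cA: "card A \<le> p" unfolding p_def by (rule card_mono) auto
  \<comment> \<open>For smaller p the constant \<open>hyp_const k\<close> alone would exceed p ^ e,
    and hence |A| ^ e.\<close>
  have p_big: "prime_const k \<le> p"
  proof (rule ccontr)
    assume "\<not> prime_const k \<le> p"
    then have "p ^ e < prime_const k ^ e" using e_gt by (intro power_strict_mono) auto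
    also have "\<dots> \<le> hyp_const k"
      using consts_pos(1)[of k] unfolding hyp_const_def e_def by simp
    also have "\<dots> \<le> hyp_const k * p ^ f" using p1 by simp
    also have "\<dots> \<le> p ^ e" using hyp' cA by (meson order_trans power_mono zero_le)
    finally show False by simp
  qed
  have hyp2: "2 ^ e * H * p ^ f \<le> card A ^ e"
  proof -
    have "2 ^ e * H \<le> hyp_const k"
      using consts_pos(2)[of k] unfolding hyp_const_def e_def H_def by simp
    then have "2 ^ e * H * p ^ f \<le> hyp_const k * p ^ f" by (rule mult_right_mono) simp
    then show ?thesis using hyp' by linarith
  qed
  \<comment> \<open>From |A| <= 2 * (|A| - 1), the factor 2 ^ e in \<open>hyp2\<close> pays for the
    removal of 0 from A.\<close>
  have cA2: "card A \<ge> 2"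
  proof (rule ccontr)
    assume "\<not> card A \<ge> 2"
    then have "card A ^ e \<le> 1" using power_mono[of "card A" 1 e] by simp
    moreover have "2 ^ e * (H * p ^ f) \<ge> 2 ^ e * 1" using H1 p1 by (intro mult_left_mono) auto
    moreover have "(2::nat) ^ e > 1" using e_gt by (intro one_less_power) auto
    ultimately show False using hyp2 by (simp add: mult.assoc)
  qed
  have "2 ^ e * (H * p ^ f) \<le> 2 ^ e * (card A - 1) ^ e"
  proof -
    have "card A ^ e \<le> (2 * (card A - 1)) ^ e" using cA2 by (intro power_mono) auto
    then have "card A ^ e \<le> 2 ^ e * (card A - 1) ^ e" by (simp only: power_mult_distrib)
    then show ?thesis using hyp2 unfolding mult.assoc by (rule order_trans[rotated])
  qed
  then have A1: "H * p ^ f \<le> (card A - 1) ^ e" by simp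
  define n where "n = (LEAST n. H * p ^ f \<le> n ^ e)"
  have n: "H * p ^ f \<le> n ^ e" unfolding n_def by (rule LeastI[of "\<lambda>n. H * p ^ f \<le> n ^ e", OF A1])
  have n_le: "n \<le> card A - 1" unfolding n_def by (rule Least_le[of "\<lambda>n. H * p ^ f \<le> n ^ e", OF A1])
  have n0: "n > 0" using n H1 p1 e_gt by (cases n) (auto simp: power_0_left)
  have n_up: "n ^ e \<le> 2 ^ e * H * p ^ f"
  proof (cases "n = 1")
    case True
    have "(1::nat) \<le> 2 ^ e * H * p ^ f" using H1 p1 by (simp add: Suc_le_eq)
    then show ?thesis using True by simp
  next
    case False
    have least: "\<not> H * p ^ f \<le> (n - 1) ^ e"
      unfolding n_def by (rule not_less_Least) (use n0 in \<open>simp add: n_def\<close>)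
    have "n ^ e \<le> (2 * (n - 1)) ^ e" using False n0 by (intro power_mono) auto
    also have "\<dots> = 2 ^ e * (n - 1) ^ e" by (rule power_mult_distrib)
    also have "\<dots> \<le> 2 ^ e * (H * p ^ f)" using least by (intro mult_left_mono) auto
    finally show ?thesis by (simp only: mult.assoc)
  qed
  have small: "1600 * n\<^sup>2 \<le> p"
  proof (rule ccontr)
    assume "\<not> 1600 * n\<^sup>2 \<le> p"
    \<comment> \<open>Minimality bounds n ^ e from above, so p ^ e would be less than p ^ (2 * f +
      1). This contradicts 2 * f < e, which holds because k >= 2.\<close>
    then have "p ^ e < (1600 * n\<^sup>2) ^ e" using e_gt by (intro power_strict_mono) auto
    also have "\<dots> = 1600 ^ e * (n ^ e)\<^sup>2"
      by (simp only: power_mult_distrib power_mult[symmetric] mult.commute[of 2 e])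
    also have "\<dots> \<le> 1600 ^ e * (2 ^ e * H * p ^ f)\<^sup>2"
      using n_up by (intro mult_left_mono power_mono) auto
    also have "\<dots> = prime_const k * p ^ (2 * f)"
      unfolding prime_const_def e_def[symmetric] H_def[symmetric]
      by (simp only: power_mult_distrib power_mult[symmetric] mult.commute[of f 2] mult.assoc)
    also have "\<dots> \<le> p * p ^ (2 * f)" using p_big by (rule mult_right_mono) simp
    also have "\<dots> = p ^ (2 * f + 1)" by simp
    also have "\<dots> \<le> p ^ e" using e_gt p1 by (intro power_increasing) auto
    finally show False by simp
  qed
  have "n \<le> card (A - {0})"
    using n_le by (cases "0 \<in> A") (auto simp: card_Diff_singleton)
  then obtain A' where A': "A' \<subseteq> A - {0}" "card A' = n"
    by (meson obtain_subset_with_card_n)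
  define D where "D = square_sums A' k"
  have "H * p ^ f \<le> 512 ^ 2 ^ (k + 1) * card D ^ 2 ^ k"
    using card_square_sums_ge[OF char, of A' k] A' small n unfolding D_def p_def e_def
    by (auto intro: order_trans)
  \<comment> \<open>Cancelling the growth constant in \<open>size_const k\<close> leaves 4 ^ f.
    Since 2 * f = 2 ^ k, the f-th root is 4 * p <= |D|^2.\<close>
  then have "512 ^ 2 ^ (k + 1) * (4 * p) ^ f \<le> 512 ^ 2 ^ (k + 1) * ((card D)\<^sup>2) ^ f"
    unfolding H_def size_const_def f_def[symmetric] power_mult[symmetric] f2k
    by (simp add: power_mult_distrib mult.assoc)
  then have "(4 * p) ^ f \<le> ((card D)\<^sup>2) ^ f" by simp
  then have big: "4 * CARD('a) \<le> (card D)\<^sup>2"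
    using f2 unfolding p_def by (subst (asm) power_mono_iff) auto
  have "1 \<le> n\<^sup>2" using n0 by (simp add: Suc_le_eq)
  then have "7 \<le> CARD('a)" using small unfolding p_def by linarith
  from card_quotients_of_sumset[OF big this]
  have "CARD('a) \<le> 3 * card {t. \<exists>a\<in>square_sums A' (2 * k). \<exists>b\<in>square_sums A' (2 * k). b \<noteq> 0 \<and> t * b = a}"
    unfolding D_def mult_2 square_sums_add .
  also have "\<dots> \<le> 3 * card {t. \<exists>a\<in>S. \<exists>b\<in>S. b \<noteq> 0 \<and> t * b = a}"
    using square_sums_mono[of A' A "2 * k"] A'(1) unfolding S_def
    by (intro mult_left_mono card_mono) auto
  finally show ?thesis .
qed

section \<open>Transfer to integer residues\<close>

lemma square_sums_of_int:
  fixes A :: "int set"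
  shows "square_sums (of_int ` A) d =
    {of_int (\<Sum>i<d. (x i - y i)\<^sup>2) | x y. x \<in> point_set d A \<and> y \<in> point_set d A}"
proof (induction d)
  case 0
  show ?case by (auto simp: point_set_def)
next
  case (Suc d)
  have ext: "x(d := a) \<in> point_set (Suc d) A" if "x \<in> point_set d A" "a \<in> A" for x a
    using that unfolding point_set_def by (auto simp: PiE_def extensional_def)
  have res: "restrict x {0..<d} \<in> point_set d A" "x d \<in> A" if "x \<in> point_set (Suc d) A" for x
    using that unfolding point_set_def by auto
  show ?case
  proof (intro equalityI subsetI)
    fix u assume "u \<in> square_sums (of_int ` A :: 'a set) (Suc d)"
    then obtain a b x y where u: "u = (of_int a - of_int b)\<^sup>2 + of_int (\<Sum>i<d. (x i - y i)\<^sup>2)"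
      and mem: "a \<in> A" "b \<in> A" "x \<in> point_set d A" "y \<in> point_set d A"
      unfolding square_sums.simps Suc by blast
    have "u = of_int (\<Sum>i<Suc d. ((x(d := a)) i - (y(d := b)) i)\<^sup>2)"
      by (simp add: u add.commute)
    then show "u \<in> {of_int (\<Sum>i<Suc d. (x i - y i)\<^sup>2) | x y. x \<in> point_set (Suc d) A \<and> y \<in> point_set (Suc d) A}"
      using ext mem by blast
  next
    fix u :: 'a
    assume "u \<in> {of_int (\<Sum>i<Suc d. (x i - y i)\<^sup>2) | x y. x \<in> point_set (Suc d) A \<and> y \<in> point_set (Suc d) A}"
    then obtain x y where u: "u = of_int (\<Sum>i<Suc d. (x i - y i)\<^sup>2)"
      and x: "x \<in> point_set (Suc d) A" and y: "y \<in> point_set (Suc d) A" by blast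
    have "u = (of_int (x d) - of_int (y d))\<^sup>2 +
        of_int (\<Sum>i<d. (restrict x {0..<d} i - restrict y {0..<d} i)\<^sup>2)"
      by (simp add: u add.commute)
    moreover have "of_int (\<Sum>i<d. (restrict x {0..<d} i - restrict y {0..<d} i)\<^sup>2) \<in> square_sums (of_int ` A :: 'a set) d"
      unfolding Suc using res x y by blast
    ultimately show "u \<in> square_sums (of_int ` A) (Suc d)"
      using res[OF x] res[OF y] by auto
  qed
qed

text \<open>The claim with its hypothesis raised to a power that makes all exponents integral. As a
  predicate on the number p it can be proved first for cardinalities of types.\<close>

definition quotient_bound :: "nat \<Rightarrow> nat \<Rightarrow> bool" where
  "quotient_bound k p \<longleftrightarrow> (\<forall>A \<subseteq> {0..<int p}. hyp_const k * p ^ 2 ^ (k - 1) \<le> card A ^ (2 ^ (k + 1) - 2) \<longrightarrow>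
     p \<le> 3 * card (quot_set p (dist_set p (2 * k) (point_set (2 * k) A))))"

lemma quotient_bound_CARD:
  assumes "k \<ge> 2"
  shows "quotient_bound k CARD('n::prime_card)"
  unfolding quotient_bound_def
proof (intro allI impI)
  let ?p = "CARD('n)"
  let ?\<phi> = "of_int :: int \<Rightarrow> 'n mod_ring"
  fix A assume A: "A \<subseteq> {0..<int ?p}" and hyp: "hyp_const k * ?p ^ 2 ^ (k - 1) \<le> card A ^ (2 ^ (k + 1) - 2)"
  define D where "D = dist_set ?p (2 * k) (point_set (2 * k) A)"
  have \<phi>_eq: "?\<phi> x = ?\<phi> y \<longleftrightarrow> [x = y] (mod int ?p)" for x y
    by (simp add: of_int_eq_iff_cong_CHAR)
  have inj: "inj_on ?\<phi> {0..<int ?p}"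
    by (auto simp: inj_on_def \<phi>_eq cong_def)
  have "card (?\<phi> ` {0..<int ?p}) = CARD('n mod_ring)"
    using card_image[OF inj] by simp
  then have surj: "?\<phi> ` {0..<int ?p} = UNIV"
    by (intro card_subset_eq) auto
  have char: "of_nat i \<noteq> (0 :: 'n mod_ring)" if "0 < i" "i < CARD('n mod_ring)" for i
    using that by (auto simp: of_nat_eq_0_iff_char_dvd dest: dvd_imp_le)
  have D: "square_sums (?\<phi> ` A) (2 * k) = ?\<phi> ` D"
  proof -
    have eq: "?\<phi> (\<Sum>i<2 * k. (x i - y i)\<^sup>2) = ?\<phi> (fp_dist ?p (2 * k) x y)" for x y
      unfolding \<phi>_eq fp_dist_def by (simp add: cong_def)
    show ?thesis
      unfolding square_sums_of_int D_def dist_set_def eq by blast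
  qed
  have card_A: "card (?\<phi> ` A) = card A"
    using inj A by (intro card_image) (rule inj_on_subset)
  have le: "CARD('n mod_ring) \<le> 3 * card {t. \<exists>a\<in>?\<phi> ` D. \<exists>b\<in>?\<phi> ` D. b \<noteq> 0 \<and> t * b = a}"
    unfolding D[symmetric]
  proof (rule card_quotients_of_square_sums[OF char assms])
    show "hyp_const k * CARD('n mod_ring) ^ 2 ^ (k - 1) \<le> card (?\<phi> ` A) ^ (2 ^ (k + 1) - 2)"
      using hyp by (simp only: card_A CARD_mod_ring)
  qed
  have "{t. \<exists>a\<in>?\<phi> ` D. \<exists>b\<in>?\<phi> ` D. b \<noteq> 0 \<and> t * b = a} \<subseteq> ?\<phi> ` quot_set ?p D"
  proof
    fix t assume "t \<in> {t. \<exists>a\<in>?\<phi> ` D. \<exists>b\<in>?\<phi> ` D. b \<noteq> 0 \<and> t * b = a}"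
    then obtain u v where uv: "u \<in> ?\<phi> ` D" "v \<in> ?\<phi> ` D" "v \<noteq> 0" "t * v = u"
      unfolding mem_Collect_eq by (elim bexE conjE)
    obtain a where a: "a \<in> D" "u = ?\<phi> a" using uv(1) by (rule imageE)
    obtain b where b: "b \<in> D" "v = ?\<phi> b" using uv(2) by (rule imageE)
    have ab: "a \<in> D" "b \<in> D" "?\<phi> b \<noteq> 0" "t * ?\<phi> b = ?\<phi> a"
      using a b uv by simp_all
    have "t \<in> ?\<phi> ` {0..<int ?p}" unfolding surj by (rule UNIV_I)
    then obtain c where c: "t = ?\<phi> c" "c \<in> {0..<int ?p}" by (rule imageE)
    have "?\<phi> (c * b) = ?\<phi> a" using ab(4) unfolding c(1) by simp
    then have "[c * b = a] (mod int ?p)" by (simp only: \<phi>_eq)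
    moreover have "b \<noteq> 0" using ab(3) by auto
    ultimately have "c \<in> quot_set ?p D" using ab(1,2) c(2) unfolding quot_set_def by blast
    then show "t \<in> ?\<phi> ` quot_set ?p D" unfolding c(1) by (rule imageI)
  qed
  moreover have "finite (quot_set ?p D)"
    by (rule finite_subset[of _ "{0..<int ?p}"]) (auto simp: quot_set_def)
  ultimately have "card {t. \<exists>a\<in>?\<phi> ` D. \<exists>b\<in>?\<phi> ` D. b \<noteq> 0 \<and> t * b = a} \<le> card (quot_set ?p D)"
    by (rule surj_card_le[rotated])
  then have "CARD('n mod_ring) \<le> 3 * card (quot_set ?p D)"
    using le by linarith
  then show "?p \<le> 3 * card (quot_set ?p (dist_set ?p (2 * k) (point_set (2 * k) A)))"
    unfolding D_def by simp
qed

section \<open>From cardinalities of types to all primes\<close>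

text \<open>A field with \<open>p\<close> elements as a type is only available for a constant \<open>p\<close>, whereas the theorem quantifies over
  \<open>p\<close>. So let \<open>p\<close> be a prime that violates the bound, if there is one, and refute this for the type of that size.\<close>

definition critical_prime :: nat where
  "critical_prime = (if \<exists>p. prime p \<and> (\<exists>k\<ge>2. \<not> quotient_bound k p)
     then SOME p. prime p \<and> (\<exists>k\<ge>2. \<not> quotient_bound k p) else 2)"

lemma prime_critical_prime: "prime critical_prime"
  unfolding critical_prime_def using someI_ex[of "\<lambda>p. prime p \<and> (\<exists>k\<ge>2. \<not> quotient_bound k p)"] by auto

typedef critical_index = "{..<critical_prime}"
  using prime_gt_0_nat[OF prime_critical_prime] by blast

lemma CARD_critical_index: "CARD(critical_index) = critical_prime"
  using type_definition.card[OF type_definition_critical_index] by simp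

instance critical_index :: prime_card
  by standard (simp add: CARD_critical_index prime_critical_prime)

lemma quotient_bound_prime:
  assumes "prime p" "k \<ge> 2"
  shows "quotient_bound k p"
proof (rule ccontr)
  assume "\<not> quotient_bound k p"
  then have "\<exists>p. prime p \<and> (\<exists>k\<ge>2. \<not> quotient_bound k p)" using assms by blast
  then have "\<exists>k\<ge>2. \<not> quotient_bound k critical_prime"
    unfolding critical_prime_def using someI_ex[of "\<lambda>p. prime p \<and> (\<exists>k\<ge>2. \<not> quotient_bound k p)"] by auto
  then show False
    using quotient_bound_CARD[where 'n = critical_index] unfolding CARD_critical_index by blast
qed

section \<open>From real exponents to the integral bound\<close>

theorem theorem1p3:
  fixes k :: nat
  assumes "k \<ge> 2"
  shows "\<exists>C::real. C > 0 \<and>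
    (\<forall>(p::nat) (A::int set).
       prime p \<longrightarrow> odd p \<longrightarrow> A \<subseteq> {0..<int p} \<longrightarrow>
       real (card (point_set (2*k) A)) \<ge>
         C * real p powr (real (2*k) / 2
              - (real (2*k) / 2) * ((2^k - 2^(k-1) - 1) / (2^k - 1)))
       \<longrightarrow> real (card (quot_set p (dist_set p (2*k) (point_set (2*k) A)))) \<ge> real p / 3)"
proof (intro exI[of _ "real (hyp_const k)"] conjI allI impI)
  show "real (hyp_const k) > 0" by (simp add: consts_pos)
  fix p :: nat and A :: "int set"
  assume p: "prime p" and A: "A \<subseteq> {0..<int p}"
    and hyp: "real (card (point_set (2*k) A)) \<ge> real (hyp_const k) * real p powr (real (2*k) / 2
              - (real (2*k) / 2) * ((2^k - 2^(k-1) - 1) / (2^k - 1)))"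
  define n where "n = card A"
  define \<theta> where "\<theta> = real (2*k) / 2 - (real (2*k) / 2) * ((2^k - 2^(k-1) - 1) / (2^k - 1))"
  \<comment> \<open>Raising the hypothesis to the power \<rho> turns the exponents \<theta> and 2 *
    k into the integers 2 ^ (k - 1) and 2 ^ (k + 1) - 2.\<close>
  define \<rho> where "\<rho> = (2^k - 1) / real k"
  have k2: "(2::real)^k = 2 * 2^(k-1)" using assms by (cases k) auto
  have k_le: "real k \<le> 2^k - 1"
  proof -
    have "Suc k \<le> 2 ^ k" by (rule Suc_leI[OF less_exp])
    then have "real (Suc k) \<le> real (2 ^ k)" by (simp only: of_nat_le_iff)
    then show ?thesis by simp
  qed
  have k0: "real k > 0" using assms by simp
  have \<rho>: "\<rho> \<ge> 1" using k_le k0 by (simp add: \<rho>_def)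
  have \<theta>\<rho>: "\<theta> * \<rho> = 2^(k-1)"
  proof -
    define z where "z = (2::real)^(k-1)"
    have z: "2 * z - 1 > 0" using k_le k0 unfolding z_def k2 by linarith
    have "\<theta> = real k * (1 - (z - 1) / (2 * z - 1))"
      unfolding \<theta>_def k2 z_def[symmetric] by (simp add: algebra_simps)
    also have "1 - (z - 1) / (2 * z - 1) = z / (2 * z - 1)"
      using z by (simp add: field_simps)
    finally have "\<theta> = real k * (z / (2 * z - 1))" .
    moreover have "\<rho> = (2 * z - 1) / real k" unfolding \<rho>_def k2 z_def[symmetric] ..
    ultimately show ?thesis using z k0 unfolding z_def[symmetric] by simp
  qed
  have card_E: "card (point_set (2*k) A) = n ^ (2*k)"
    by (simp add: point_set_def card_PiE n_def)
  have p0: "real p > 0" using prime_gt_0_nat[OF p] by simp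
  have c1: "real (hyp_const k) \<ge> 1" using consts_pos(3)[of k] by linarith
  have lhs: "0 < real (hyp_const k) * real p powr \<theta>" using c1 p0 by simp
  then have n0: "n > 0"
    using hyp assms unfolding card_E \<theta>_def[symmetric] by (cases n) (auto simp: power_0_left)
  \<comment> \<open>Both \<rho> and the constant are at least 1, so the power does not decrease the
    constant.\<close>
  have "real (hyp_const k) * real p powr 2^(k-1) \<le> real (hyp_const k) powr \<rho> * real p powr 2^(k-1)"
    using powr_mono[OF \<rho> c1] c1 by (intro mult_right_mono) auto
  also have "\<dots> = (real (hyp_const k) * real p powr \<theta>) powr \<rho>"
    using c1 p0 by (simp add: powr_mult powr_powr \<theta>\<rho>)
  also have "\<dots> \<le> (real (n ^ (2*k))) powr \<rho>"
    using hyp lhs \<rho> unfolding card_E \<theta>_def[symmetric] by (intro powr_mono2) auto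
  also have "\<dots> = real n powr (real (2*k) * \<rho>)"
    using n0 by (simp add: powr_powr flip: powr_realpow)
  also have "real (2*k) * \<rho> = real (2 ^ (k + 1) - 2)"
  proof -
    have "(2::nat) \<le> 2 ^ (k + 1)" by simp
    then show ?thesis using k0 by (simp add: \<rho>_def of_nat_diff)
  qed
  also have "real n powr real (2 ^ (k + 1) - 2) = real (n ^ (2 ^ (k + 1) - 2))"
    using n0 powr_realpow[of "real n" "2 ^ (k + 1) - 2"] by (simp only: of_nat_power of_nat_0_less_iff)
  finally have "real (hyp_const k) * real p powr 2^(k-1) \<le> real (n ^ (2 ^ (k + 1) - 2))" .
  moreover have "real p powr 2^(k-1) = real (p ^ 2 ^ (k - 1))"
    using powr_realpow[OF p0, of "2 ^ (k - 1)"] by simp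
  ultimately have "real (hyp_const k * p ^ 2 ^ (k - 1)) \<le> real (n ^ (2 ^ (k + 1) - 2))"
    by (simp only: of_nat_mult)
  then have "hyp_const k * p ^ 2 ^ (k - 1) \<le> card A ^ (2 ^ (k + 1) - 2)"
    unfolding n_def by (simp only: of_nat_le_iff)
  then have "p \<le> 3 * card (quot_set p (dist_set p (2*k) (point_set (2*k) A)))"
    using quotient_bound_prime[OF p assms] A unfolding quotient_bound_def by blast
  then show "real (card (quot_set p (dist_set p (2*k) (point_set (2*k) A)))) \<ge> real p / 3"
    by linarith
qed

end
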